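(* Let $P$ and $Q$ be probability distributions on $\mathcal{Z}$, let $X_1,\dots,X_n$ be i.i.d. from $P$ and $Y_1,\dots,Y_m$ i.i.d. from $Q$, where $m=m_n\to\infty$ as $n\to\infty$. Let $\mathcal{H}$ be an RKHS with kernel $k$ on $\mathcal{Z}$ for which there exists $\varepsilon>0$ with $$\sqrt{\varepsilon}\le k(x,x')\le 1\qquad\text{for all }x,x'\in\mathcal{Z},$$ and assume that the Gram matrix $K_{11}=(k(X_i,X_{i'}))_{i,i'=1}^n$ is almost surely positive definite. Let $\psi$ be a convex, twice differentiable function, let $\lambda=\lambda_{n,m}>0$, and let $\widehat w$ be the minimizer of $$\frac1n\sum_{i=1}^n\psi(w(X_i))-\frac1m\sum_{j=1}^m w(Y_j)+\frac{\lambda}{2}\|w\|_{\mathcal{H}}^2$$ over functions of the form $w=\sum_{i=1}^n\alpha_ik(\cdot,X_i)+\frac{1}{m\lambda}\sum_{j=1}^mk(\cdot,Y_j)$, $\alpha_1,\dots,\alpha_n\in\mathbb{R}$. Let $$H=\frac1nK_{11}D_{\psi,\widehat w}K_{11}+\lambda K_{11},\qquad D_{\psi,\widehat w}=\mathrm{diag}\big(\psi''(\widehat w(X_1)),\dots,\psi''(\widehat w(X_n))\big),$$ and let $F_n$ be the distribution function of $T_n=\max_{1\le i\le n}\psi''(\widehat w(X_i))$. Suppose there exist sequences $s_n$ and $t_n$ with $$\lim_{n\to\infty}s_n=\infty,\qquad\lim_{n\to\infty}F_n(s_n)=0,\qquad\lim_{n\to\infty}F_n(t_n)=1,$$ that there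 exists $M>0$ such that $E[\psi''(\widehat w(X_1))]\le M$ for all sufficiently large $n,m$, and that $\lim_{n\to\infty}\lambda_{n,m}<\infty$. Then for any small $\nu>0$ (i.e. $0<\nu<1$), $$\lim_{n\to\infty}\Pr\Big(s_n^{1-\nu}\le\kappa(H)\le\kappa(K_{11})\Big(1+\frac{t_n}{\lambda}\Big)\Big)=1.$$
   Context: For a symmetric positive definite matrix $A$, $\kappa(A)=\lambda_{\max}(A)/\lambda_{\min}(A)$. Probabilities and expectations are with respect to the joint law of $X_1,\dots,X_n,Y_1,\dots,Y_m$. The minimizer $\widehat w$ is assumed to exist. *)

theory Defs
  imports
    "HOL-Probability.Probability"
    "Jordan_Normal_Form.Char_Poly"
begin

definition pos_def_mat :: "real mat \<Rightarrow> bool" where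
  "pos_def_mat A \<longleftrightarrow>
     square_mat A \<and> transpose_mat A = A \<and>
     (\<forall>v \<in> carrier_vec (dim_row A). v \<noteq> 0\<^sub>v (dim_row A) \<longrightarrow> 0 < scalar_prod v (A *\<^sub>v v))"

text \<open>Only meaningful for symmetric matrices of positive size, whose set of real eigenvalues is
  finite and nonempty.\<close>

definition cond_num :: "real mat \<Rightarrow> real" where
  "cond_num A = Max {e. eigenvalue A e} / Min {e. eigenvalue A e}"

text \<open>The base set is the whole type \<open>'z\<close>. The Hilbert space is given by its set \<open>H\<close> of functions
  together with an inner product \<open>ip\<close>, of which only the values on \<open>H\<close> matter.\<close>

definition rkhs_norm :: "(('z \<Rightarrow> real) \<Rightarrow> ('z \<Rightarrow> real) \<Rightarrow> real) \<Rightarrow> ('z \<Rightarrow> real) \<Rightarrow> real" where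
  "rkhs_norm ip f = sqrt (ip f f)"

locale rkhs =
  fixes H :: "('z \<Rightarrow> real) set"
    and ip :: "('z \<Rightarrow> real) \<Rightarrow> ('z \<Rightarrow> real) \<Rightarrow> real"
    and k :: "'z \<Rightarrow> 'z \<Rightarrow> real"
  assumes zero_mem: "(\<lambda>z. 0) \<in> H"
    and add_mem: "f \<in> H \<Longrightarrow> g \<in> H \<Longrightarrow> (\<lambda>z. f z + g z) \<in> H"
    and scale_mem: "f \<in> H \<Longrightarrow> (\<lambda>z. c * f z) \<in> H"
    and ip_sym: "f \<in> H \<Longrightarrow> g \<in> H \<Longrightarrow> ip f g = ip g f"
    and ip_add: "f \<in> H \<Longrightarrow> g \<in> H \<Longrightarrow> h \<in> H \<Longrightarrow> ip (\<lambda>z. f z + g z) h = ip f h + ip g h"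
    and ip_scale: "f \<in> H \<Longrightarrow> g \<in> H \<Longrightarrow> ip (\<lambda>z. c * f z) g = c * ip f g"
    and ip_nonneg: "f \<in> H \<Longrightarrow> 0 \<le> ip f f"
    and ip_definite: "f \<in> H \<Longrightarrow> ip f f = 0 \<Longrightarrow> f = (\<lambda>z. 0)"
    and complete: "(\<And>i. \<sigma> i \<in> H) \<Longrightarrow>
          \<forall>e>0. \<exists>N. \<forall>i\<ge>N. \<forall>j\<ge>N. rkhs_norm ip (\<lambda>z. \<sigma> i z - \<sigma> j z) < e \<Longrightarrow>
          \<exists>f\<in>H. (\<lambda>i. rkhs_norm ip (\<lambda>z. \<sigma> i z - f z)) \<longlonglongrightarrow> 0"
    and kernel_mem: "(\<lambda>z. k z x) \<in> H"
    and reproducing: "f \<in> H \<Longrightarrow> ip f (\<lambda>z. k z x) = f x"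

text \<open>The joint law of \<open>n\<close> independent draws from \<open>P\<close> and, independently of these, \<open>m\<close> independent
  draws from \<open>Q\<close>. A point of the space is a pair \<open>(x, y)\<close> of samples, indexed from 0.\<close>

definition sample_law :: "'z measure \<Rightarrow> 'z measure \<Rightarrow> nat \<Rightarrow> nat \<Rightarrow> ((nat \<Rightarrow> 'z) \<times> (nat \<Rightarrow> 'z)) measure" where
  "sample_law P Q n m = PiM {..<n} (\<lambda>_. P) \<Otimes>\<^sub>M PiM {..<m} (\<lambda>_. Q)"

definition gram_mat :: "('z \<Rightarrow> 'z \<Rightarrow> real) \<Rightarrow> nat \<Rightarrow> (nat \<Rightarrow> 'z) \<Rightarrow> real mat" where
  "gram_mat k n x = Matrix.mat n n (\<lambda>(i, j). k (x i) (x j))"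

definition kernel_model ::
    "('z \<Rightarrow> 'z \<Rightarrow> real) \<Rightarrow> real \<Rightarrow> nat \<Rightarrow> nat \<Rightarrow> (nat \<Rightarrow> 'z) \<Rightarrow> (nat \<Rightarrow> 'z) \<Rightarrow> ('z \<Rightarrow> real) set" where
  "kernel_model k l n m x y =
     {w. \<exists>\<alpha> :: nat \<Rightarrow> real.
        w = (\<lambda>z. (\<Sum>i<n. \<alpha> i * k z (x i)) + 1 / (real m * l) * (\<Sum>j<m. k z (y j)))}"

definition objective ::
    "(real \<Rightarrow> real) \<Rightarrow> (('z \<Rightarrow> real) \<Rightarrow> ('z \<Rightarrow> real) \<Rightarrow> real) \<Rightarrow> real \<Rightarrow> nat \<Rightarrow> nat \<Rightarrow>
     (nat \<Rightarrow> 'z) \<Rightarrow> (nat \<Rightarrow> 'z) \<Rightarrow> ('z \<Rightarrow> real) \<Rightarrow> real" where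
  "objective \<psi> ip l n m x y w =
     1 / real n * (\<Sum>i<n. \<psi> (w (x i))) - 1 / real m * (\<Sum>j<m. w (y j))
       + l / 2 * (rkhs_norm ip w)\<^sup>2"

definition hessian_mat ::
    "('z \<Rightarrow> 'z \<Rightarrow> real) \<Rightarrow> (real \<Rightarrow> real) \<Rightarrow> real \<Rightarrow> nat \<Rightarrow> (nat \<Rightarrow> 'z) \<Rightarrow> ('z \<Rightarrow> real) \<Rightarrow> real mat" where
  "hessian_mat k \<psi> l n x w =
     (let K = gram_mat k n x;
          D = mat_diag n (\<lambda>i. deriv (deriv \<psi>) (w (x i)))
      in (1 / real n) \<cdot>\<^sub>m (K * D * K) + l \<cdot>\<^sub>m K)"

definition max_curv :: "(real \<Rightarrow> real) \<Rightarrow> nat \<Rightarrow> (nat \<Rightarrow> 'z) \<Rightarrow> ('z \<Rightarrow> real) \<Rightarrow> real" where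
  "max_curv \<psi> n x w = Max ((\<lambda>i. deriv (deriv \<psi>) (w (x i))) ` {..<n})"

end

theory Submission
  imports Defs "HOL-Combinatorics.Permutations" "HOL-Real_Asymp.Real_Asymp"
begin

text \<open>Write \<open>T\<close> for the largest of the curvatures \<open>d i = \<psi>''(w (X i))\<close> and \<open>A\<close> for their average.
  The quadratic form of the Hessian is \<open>(1/n) \<Sum>i. d i ((K v) i)\<^sup>2 + \<lambda> v \<bullet> K v\<close>.
  It is at least \<open>\<lambda> v \<bullet> K v\<close> and, since \<open>K \<le> n I\<close>, at most \<open>(T + \<lambda>) v \<bullet> K v\<close>, which bounds the
  condition number from above by \<open>\<kappa>(K) (1 + T / \<lambda>)\<close>. Testing it with the all-ones vector shows
  that the largest eigenvalue is at least \<open>\<epsilon> T\<close>, and testing it with a unit vector shows that the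
  smallest one is at most \<open>A + \<lambda>\<close>. The minimizer is unique by strict convexity, hence it does not
  depend on the order of the sample; so all \<open>d i\<close> have the same mean and Markov's inequality gives
  \<open>A \<le> s powr (\<nu>/2)\<close> with probability tending to 1.\<close>

unbundle no vec_syntax and no inner_syntax

section \<open>Extremal eigenvalues of symmetric matrices\<close>

definition qform :: "real mat \<Rightarrow> real vec \<Rightarrow> real" where
  "qform A v = scalar_prod v (A *\<^sub>v v)"

definition sym_mat :: "nat \<Rightarrow> real mat \<Rightarrow> bool" where
  "sym_mat n A \<longleftrightarrow> A \<in> carrier_mat n n \<and> transpose_mat A = A"

lemma sym_mat_carrier: "sym_mat n A \<Longrightarrow> A \<in> carrier_mat n n"
  by (simp add: sym_mat_def)

lemma sym_mat_iff:
  "sym_mat n A \<longleftrightarrow> A \<in> carrier_mat n n \<and> (\<forall>i<n. \<forall>j<n. A $$ (i, j) = A $$ (j, i))"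
  by (auto simp: sym_mat_def mat_eq_iff)

lemma sym_mat_uminus: "sym_mat n A \<Longrightarrow> sym_mat n (- A)"
  by (auto simp: sym_mat_iff)

lemma sym_mat_scalar_prod_swap:
  assumes "sym_mat n A" "u \<in> carrier_vec n" "v \<in> carrier_vec n"
  shows "scalar_prod u (A *\<^sub>v v) = scalar_prod v (A *\<^sub>v u)"
  using transpose_vec_mult_scalar[of A n n v u] assms
  by (simp add: sym_mat_def comm_scalar_prod[of _ n])

lemma scalar_prod_self_nonneg: "0 \<le> scalar_prod v (v :: real vec)"
  by (simp add: scalar_prod_def sum_nonneg)

lemma scalar_prod_self_pos:
  assumes "v \<in> carrier_vec n" "v \<noteq> 0\<^sub>v n"
  shows "0 < scalar_prod v (v :: real vec)"
proof -
  obtain i where "i < n" "v $ i \<noteq> 0" using assms by (auto simp: vec_eq_iff)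
  then show ?thesis using assms unfolding scalar_prod_def
    by (intro sum_pos2[of _ i]) (auto simp: zero_less_mult_iff)
qed

lemma qform_uminus:
  assumes "A \<in> carrier_mat n n" "v \<in> carrier_vec n"
  shows "qform (- A) v = - qform A v"
  using assms by (simp add: qform_def uminus_mult_mat_vec)

text \<open>Cauchy-Schwarz in each row bounds \<open>|A v|^2\<close> by the squared Frobenius norm
  times \<open>|v|^2\<close>.\<close>

lemma mult_mat_vec_sq_bound:
  fixes A :: "real mat"
  assumes A: "A \<in> carrier_mat n n"
  obtains C where "C > 0"
    "\<And>v. v \<in> carrier_vec n \<Longrightarrow> scalar_prod (A *\<^sub>v v) (A *\<^sub>v v) \<le> C * scalar_prod v v"
proof
  let ?S = "\<Sum>i<n. \<Sum>j<n. (A $$ (i, j))\<^sup>2"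
  \<comment> \<open>Adding 1 keeps the constant positive even when \<open>A\<close>
    vanishes.\<close>
  show "?S + 1 > 0" by (simp add: add_nonneg_pos sum_nonneg)
  fix v :: "real vec" assume v: "v \<in> carrier_vec n"
  have e: "(A *\<^sub>v v) $ i = (\<Sum>j<n. A $$ (i, j) * v $ j)" if "i < n" for i
    using that A v by (simp add: scalar_prod_def atLeast0LessThan)
  have "scalar_prod (A *\<^sub>v v) (A *\<^sub>v v) = (\<Sum>i<n. (\<Sum>j<n. A $$ (i, j) * v $ j)\<^sup>2)"
    using A e by (simp add: scalar_prod_def[of "A *\<^sub>v v"] atLeast0LessThan power2_eq_square)
  also have "\<dots> \<le> (\<Sum>i<n. (\<Sum>j<n. (A $$ (i, j))\<^sup>2) * (\<Sum>j<n. (v $ j)\<^sup>2))"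
    by (intro sum_mono Cauchy_Schwarz_ineq_sum)
  also have "\<dots> = ?S * scalar_prod v v"
    using v by (simp add: scalar_prod_def atLeast0LessThan power2_eq_square sum_distrib_right)
  also have "\<dots> \<le> (?S + 1) * scalar_prod v v"
    by (intro mult_right_mono scalar_prod_self_nonneg) simp
  finally show "scalar_prod (A *\<^sub>v v) (A *\<^sub>v v) \<le> (?S + 1) * scalar_prod v v" .
qed

text \<open>Since \<open>|v - A v|^2\<close> is nonnegative, \<open>2 <v, A v>\<close> is at most
  \<open>|v|^2 + |A v|^2\<close>, and the bound on \<open>|A v|^2\<close> applies.\<close>

lemma qform_bound:
  assumes A: "A \<in> carrier_mat n n"
  obtains C where "C > 0" "\<And>v. v \<in> carrier_vec n \<Longrightarrow> qform A v \<le> C * scalar_prod v v"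
proof -
  obtain C where C: "C > 0"
    "\<And>v. v \<in> carrier_vec n \<Longrightarrow> scalar_prod (A *\<^sub>v v) (A *\<^sub>v v) \<le> C * scalar_prod v v"
    using mult_mat_vec_sq_bound[OF A] by blast
  have "qform A v \<le> (C + 1) * scalar_prod v v" if v: "v \<in> carrier_vec n" for v
  proof -
    let ?w = "A *\<^sub>v v"
    have w: "?w \<in> carrier_vec n" using A v by simp
    have "0 \<le> scalar_prod (v - ?w) (v - ?w)" by (rule scalar_prod_self_nonneg)
    also have "\<dots> = scalar_prod v v - 2 * scalar_prod v ?w + scalar_prod ?w ?w"
      using v w by (simp add: minus_scalar_prod_distrib[of _ n] scalar_prod_minus_distrib[of _ n]
          comm_scalar_prod[of ?w n v])
    finally have "2 * qform A v \<le> (C + 1) * scalar_prod v v"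
      using C(2)[OF v] by (simp add: qform_def algebra_simps)
    moreover have "0 \<le> (C + 1) * scalar_prod v v"
      using C(1) scalar_prod_self_nonneg[of v] by simp
    ultimately show ?thesis by linarith
  qed
  with C(1) show thesis by (intro that[of "C + 1"]) auto
qed

text \<open>Expand \<open>qform A (v - (1 / C) A v) \<ge> 0\<close>.\<close>

lemma psd_mult_mat_vec_sq_le:
  assumes A: "sym_mat n A" and v: "v \<in> carrier_vec n" and C: "C > 0"
    and psd: "\<And>u. u \<in> carrier_vec n \<Longrightarrow> 0 \<le> qform A u"
    and ub: "\<And>u. u \<in> carrier_vec n \<Longrightarrow> qform A u \<le> C * scalar_prod u u"
  shows "scalar_prod (A *\<^sub>v v) (A *\<^sub>v v) \<le> C * qform A v"
proof -
  let ?u = "A *\<^sub>v v"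
  let ?c = "1 / C"
  have Ac: "A \<in> carrier_mat n n" using A by (rule sym_mat_carrier)
  have u: "?u \<in> carrier_vec n" "A *\<^sub>v ?u \<in> carrier_vec n" using Ac v by auto
  have "0 \<le> qform A (v - ?c \<cdot>\<^sub>v ?u)" using v u by (intro psd) auto
  also have "A *\<^sub>v (v - ?c \<cdot>\<^sub>v ?u) = ?u - ?c \<cdot>\<^sub>v (A *\<^sub>v ?u)"
    using v u Ac by (simp add: mult_minus_distrib_mat_vec mult_mat_vec)
  then have "qform A (v - ?c \<cdot>\<^sub>v ?u) =
      qform A v - ?c * scalar_prod v (A *\<^sub>v ?u) - ?c * scalar_prod ?u ?u + ?c * ?c * qform A ?u"
    using v u by (simp add: qform_def minus_scalar_prod_distrib[of _ n]
        scalar_prod_minus_distrib[of _ n] algebra_simps)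
  \<comment> \<open>By symmetry the two mixed terms are both \<open>|A v|^2 / C\<close>; the bound
    on the last term cancels one of them.\<close>
  also have "scalar_prod v (A *\<^sub>v ?u) = scalar_prod ?u ?u"
    using sym_mat_scalar_prod_swap[OF A v u(1)] .
  also have "?c * ?c * qform A ?u \<le> ?c * ?c * (C * scalar_prod ?u ?u)"
    using C ub[OF u(1)] by (intro mult_left_mono) auto
  finally have "0 \<le> qform A v - ?c * scalar_prod ?u ?u" using C by simp
  then show ?thesis using C by (simp add: field_simps)
qed

text \<open>If \<open>B\<close> inverts \<open>A\<close>, then
  \<open>|v|^2 = |B A v|^2 \<le> C' |A v|^2 \<le> C' C <v, A v>\<close>, so coercivity follows
  without a compactness argument.\<close>

lemma psd_nonsingular_coercive:
  assumes A: "sym_mat n A" and det: "det A \<noteq> 0"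
    and psd: "\<And>u. u \<in> carrier_vec n \<Longrightarrow> 0 \<le> qform A u"
  obtains c where "c > 0" "\<And>v. v \<in> carrier_vec n \<Longrightarrow> c * scalar_prod v v \<le> qform A v"
proof -
  have Ac: "A \<in> carrier_mat n n" using A by (rule sym_mat_carrier)
  obtain B where B: "B \<in> carrier_mat n n" "B * A = 1\<^sub>m n"
    using det_non_zero_imp_unit[OF Ac det] by (auto simp: Units_def ring_mat_simps)
  obtain C where C: "C > 0" "\<And>u. u \<in> carrier_vec n \<Longrightarrow> qform A u \<le> C * scalar_prod u u"
    using qform_bound[OF Ac] by blast
  obtain C' where C': "C' > 0" "\<And>u. u \<in> carrier_vec n \<Longrightarrow>
      scalar_prod (B *\<^sub>v u) (B *\<^sub>v u) \<le> C' * scalar_prod u u"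
    using mult_mat_vec_sq_bound[OF B(1)] by blast
  have "1 / (C' * C) * scalar_prod v v \<le> qform A v" if v: "v \<in> carrier_vec n" for v
  proof -
    have "B *\<^sub>v (A *\<^sub>v v) = v"
      using B Ac v by (metis assoc_mult_mat_vec one_mult_mat_vec)
    then have "scalar_prod v v \<le> C' * scalar_prod (A *\<^sub>v v) (A *\<^sub>v v)"
      using C'(2)[of "A *\<^sub>v v"] Ac v by simp
    also have "\<dots> \<le> C' * (C * qform A v)"
      using C'(1) psd_mult_mat_vec_sq_le[OF A v C(1) psd C(2)] by (intro mult_left_mono) auto
    finally show ?thesis using C(1) C'(1) by (simp add: field_simps)
  qed
  then show thesis using C(1) C'(1) by (intro that[of "1 / (C' * C)"]) auto
qed

lemma finite_eigenvalues:
  assumes "(A :: real mat) \<in> carrier_mat n n"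
  shows "finite {e. eigenvalue A e}"
proof -
  have "char_poly A \<noteq> 0" using degree_monic_char_poly[OF assms] by auto
  then show ?thesis by (simp add: eigenvalue_root_char_poly[OF assms] poly_roots_finite)
qed

text \<open>If \<open>\<mu>\<close> is the least upper bound of the Rayleigh quotients, then \<open>\<mu> I - A\<close> is positive
  semidefinite but not coercive, hence singular.\<close>

lemma ex_max_eigenvalue:
  assumes A: "sym_mat n A" and n: "n > 0"
  obtains \<mu> where "eigenvalue A \<mu>" "\<And>v. v \<in> carrier_vec n \<Longrightarrow> qform A v \<le> \<mu> * scalar_prod v v"
proof -
  have Ac: "A \<in> carrier_mat n n" using A by (rule sym_mat_carrier)
  let ?S = "{c. \<forall>v\<in>carrier_vec n. qform A v \<le> c * scalar_prod v v}"
  define \<mu> where "\<mu> = Inf ?S"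
  obtain C where "\<And>v. v \<in> carrier_vec n \<Longrightarrow> qform A v \<le> C * scalar_prod v v"
    using qform_bound[OF Ac] by metis
  then have ne: "?S \<noteq> {}" by auto
  have lb: "qform A v / scalar_prod v v \<le> c"
    if "c \<in> ?S" "v \<in> carrier_vec n" "v \<noteq> 0\<^sub>v n" for c v
    using that scalar_prod_self_pos[OF that(2,3)] by (simp add: divide_le_eq)
  \<comment> \<open>Positive dimension supplies a nonzero vector, and its Rayleigh quotient bounds
    \<open>?S\<close> from below, so that \<open>\<mu>\<close> is a genuine infimum.\<close>
  have "unit_vec n 0 \<noteq> (0\<^sub>v n :: real vec)" using n by (metis index_unit_vec(2) index_zero_vec(1) zero_neq_one)
  then have bdd: "bdd_below ?S"
    using lb[of _ "unit_vec n 0"] by (intro bdd_belowI[of _ "qform A (unit_vec n 0) / scalar_prod (unit_vec n 0) (unit_vec n 0)"]) auto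
  have mu: "qform A v \<le> \<mu> * scalar_prod v v" if v: "v \<in> carrier_vec n" for v
  proof (cases "v = 0\<^sub>v n")
    case True
    then show ?thesis using Ac by (simp add: qform_def)
  next
    case False
    then have "qform A v / scalar_prod v v \<le> \<mu>"
      unfolding \<mu>_def using ne lb v by (intro cInf_greatest) auto
    then show ?thesis using scalar_prod_self_pos[OF v False] by (simp add: divide_le_eq)
  qed
  \<comment> \<open>\<open>char_matrix A \<mu>\<close> is \<open>A - \<mu> I\<close>; the sign
    change makes it positive semidefinite.\<close>
  define B where "B = - char_matrix A \<mu>"
  have B: "sym_mat n B"
    using A by (auto simp: B_def char_matrix_def sym_mat_iff)
  have qB: "qform B v = \<mu> * scalar_prod v v - qform A v" if v: "v \<in> carrier_vec n" for v
  proof -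
    have "char_matrix A \<mu> *\<^sub>v v = A *\<^sub>v v + (- \<mu>) \<cdot>\<^sub>v v"
      using Ac v unfolding char_matrix_def
      by (subst add_mult_distrib_mat_vec[of _ n n]) auto
    then show ?thesis
      using Ac v qform_uminus[of "char_matrix A \<mu>" n v]
      by (simp add: B_def qform_def scalar_prod_add_distrib[of _ n])
  qed
  have "det B = 0"
  proof (rule ccontr)
    assume "det B \<noteq> 0"
    then obtain c where c: "c > 0" "\<And>v. v \<in> carrier_vec n \<Longrightarrow> c * scalar_prod v v \<le> qform B v"
      using psd_nonsingular_coercive[OF B] mu qB by (metis diff_ge_0_iff_ge)
    then have "\<mu> - c \<in> ?S" using qB by (force simp: algebra_simps)
    then have "\<mu> \<le> \<mu> - c" unfolding \<mu>_def using bdd by (rule cInf_lower)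
    then show False using c(1) by simp
  qed
  then obtain v where v: "v \<in> carrier_vec n" "v \<noteq> 0\<^sub>v n" "B *\<^sub>v v = 0\<^sub>v n"
    using det_0_iff_vec_prod_zero_field[OF sym_mat_carrier[OF B]] by auto
  have "char_matrix A \<mu> *\<^sub>v v = (- B) *\<^sub>v v" by (simp add: B_def)
  also have "\<dots> = - (B *\<^sub>v v)"
    using v(1) carrier_matD(2)[OF sym_mat_carrier[OF B]] by (intro uminus_mult_mat_vec) auto
  also have "\<dots> = 0\<^sub>v n" using v(3) by auto
  finally have "eigenvalue A \<mu>" using v by (auto simp: eigenvalue_char_matrix[OF Ac])
  then show thesis using mu that by blast
qed

lemma eigenvalue_qform:
  assumes "A \<in> carrier_mat n n" "eigenvalue A e"
  obtains v where "v \<in> carrier_vec n" "scalar_prod v v > 0" "qform A v = e * scalar_prod v v"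
  using assms scalar_prod_self_pos
  by (auto simp: eigenvalue_def eigenvector_def qform_def carrier_matD)

text \<open>An eigenvector forces every Rayleigh bound to be at least its eigenvalue, and some
  eigenvalue is itself a Rayleigh bound. This variational form turns all later eigenvalue estimates
  into estimates of quadratic forms.\<close>

lemma Max_eigenvalue_le_iff:
  assumes A: "sym_mat n A" and n: "n > 0"
  shows "Max {e. eigenvalue A e} \<le> c \<longleftrightarrow> (\<forall>v\<in>carrier_vec n. qform A v \<le> c * scalar_prod v v)"
proof -
  have Ac: "A \<in> carrier_mat n n" using A by (rule sym_mat_carrier)
  obtain \<mu> where mu: "eigenvalue A \<mu>"
    "\<And>v. v \<in> carrier_vec n \<Longrightarrow> qform A v \<le> \<mu> * scalar_prod v v"
    using ex_max_eigenvalue[OF A n] by blast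
  have le: "e \<le> d" if "eigenvalue A e"
    and "\<And>v. v \<in> carrier_vec n \<Longrightarrow> qform A v \<le> d * scalar_prod v v" for e d
    using eigenvalue_qform[OF Ac that(1)] that(2) by (metis mult_le_cancel_right_pos)
  have "Max {e. eigenvalue A e} = \<mu>"
    using mu le by (intro Max_eqI finite_eigenvalues[OF Ac]) auto
  moreover have "qform A v \<le> c * scalar_prod v v" if "\<mu> \<le> c" "v \<in> carrier_vec n" for v
    using mu(2)[OF that(2)] mult_right_mono[OF that(1) scalar_prod_self_nonneg[of v]] by linarith
  ultimately show ?thesis using le[OF mu(1)] by auto
qed

text \<open>Negation reflects the spectrum, so facts about the largest eigenvalue transfer to the
  smallest.\<close>

lemma Min_eigenvalue_eq:
  assumes A: "sym_mat n A" and n: "n > 0"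
  shows "Min {e. eigenvalue A e} = - Max {e. eigenvalue (- A) e}"
proof -
  have Ac: "A \<in> carrier_mat n n" using A by (rule sym_mat_carrier)
  have "- A *\<^sub>v v = e \<cdot>\<^sub>v v \<longleftrightarrow> A *\<^sub>v v = (- e) \<cdot>\<^sub>v v" if v: "v \<in> carrier_vec n" for v e
  proof -
    have "- A *\<^sub>v v = - (A *\<^sub>v v)" using Ac v by (simp add: uminus_mult_mat_vec)
    moreover have "- a = b \<longleftrightarrow> a = - b" for a b :: real by auto
    ultimately show ?thesis using Ac v by (auto simp: vec_eq_iff simp del: index_mult_mat_vec)
  qed
  then have "eigenvalue (- A) e \<longleftrightarrow> eigenvalue A (- e)" for e
    using carrier_matD(1)[OF Ac] unfolding eigenvalue_def eigenvector_def
    by (intro iff_exI) (simp cong: conj_cong)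
  then have "{e. eigenvalue (- A) e} = uminus ` {e. eigenvalue A e}" by force
  moreover have "{e. eigenvalue A e} \<noteq> {}" using ex_max_eigenvalue[OF A n] by auto
  ultimately show ?thesis
    using finite_eigenvalues[OF Ac]
    by (simp add: minus_Max_eq_Min image_image del: Collect_empty_eq)
qed

lemma le_Min_eigenvalue_iff:
  assumes A: "sym_mat n A" and n: "n > 0"
  shows "c \<le> Min {e. eigenvalue A e} \<longleftrightarrow> (\<forall>v\<in>carrier_vec n. c * scalar_prod v v \<le> qform A v)"
  using Max_eigenvalue_le_iff[OF sym_mat_uminus[OF A] n, of "- c"] sym_mat_carrier[OF A]
  by (auto simp: Min_eigenvalue_eq[OF A n] qform_uminus le_minus_iff)

section \<open>Measurability of the condition number\<close>

lemma qform_eq_sum: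
  assumes "A \<in> carrier_mat n n" "v \<in> carrier_vec n"
  shows "qform A v = (\<Sum>i<n. \<Sum>j<n. v $ i * A $$ (i, j) * v $ j)"
  using assms
  by (simp add: qform_def scalar_prod_def atLeast0LessThan sum_distrib_left mult.assoc)

lemma ex_rat_sequence:
  "\<exists>r :: nat \<Rightarrow> rat. (\<lambda>k. real_of_rat (r k)) \<longlonglongrightarrow> x"
proof -
  define r where "r k = (SOME q. x < real_of_rat q \<and> real_of_rat q < x + inverse (real (Suc k)))" for k
  have r: "x < real_of_rat (r k) \<and> real_of_rat (r k) < x + inverse (real (Suc k))" for k
    unfolding r_def by (rule someI_ex, rule of_rat_dense) simp
  have le: "x \<le> real_of_rat (r k)" for k
    using r[of k] by linarith
  have ge: "real_of_rat (r k) \<le> x + inverse (real (Suc k))" for k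
    using r[of k] by linarith
  have "(\<lambda>k. real_of_rat (r k)) \<longlonglongrightarrow> x"
    by (rule tendsto_sandwich[OF _ _ tendsto_const LIMSEQ_inverse_real_of_nat_add])
      (rule always_eventually allI le ge)+
  then show ?thesis by (rule exI[of _ r])
qed

text \<open>Coding by lists makes countability immediate. For a list shorter than \<open>n\<close>
  the missing entries are still rational numbers, so no length condition is imposed.\<close>

definition rat_vecs :: "nat \<Rightarrow> real vec set" where
  "rat_vecs n = range (\<lambda>qs :: rat list. vec n (\<lambda>i. real_of_rat (qs ! i)))"

lemma countable_rat_vecs: "countable (rat_vecs n)"
  by (simp add: rat_vecs_def)

lemma rat_vecs_carrier: "rat_vecs n \<subseteq> carrier_vec n"
  by (auto simp: rat_vecs_def)

text \<open>Both sides are continuous in \<open>v\<close> and rational vectors are dense. A Rayleigh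
  bound thereby becomes a countable family of inequalities, as measurability requires.\<close>

lemma qform_le_iff_rat_vecs:
  assumes A: "A \<in> carrier_mat n n"
  shows "(\<forall>v\<in>carrier_vec n. qform A v \<le> c * scalar_prod v v) \<longleftrightarrow>
    (\<forall>v\<in>rat_vecs n. qform A v \<le> c * scalar_prod v v)"
proof
  assume rat: "\<forall>v\<in>rat_vecs n. qform A v \<le> c * scalar_prod v v"
  show "\<forall>v\<in>carrier_vec n. qform A v \<le> c * scalar_prod v v"
  proof
    fix v :: "real vec" assume v: "v \<in> carrier_vec n"
    have "\<forall>i. \<exists>r. (\<lambda>k. real_of_rat (r k)) \<longlonglongrightarrow> v $ i"
      by (rule allI, rule ex_rat_sequence)
    from choice[OF this] obtain r where "\<forall>i. (\<lambda>k. real_of_rat (r i k)) \<longlonglongrightarrow> v $ i" ..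
    then have r: "(\<lambda>k. real_of_rat (r i k)) \<longlonglongrightarrow> v $ i" for i ..
    define V where "V k = vec n (\<lambda>i. real_of_rat (r i k))" for k
    have V: "V k \<in> rat_vecs n" for k
      unfolding rat_vecs_def V_def
      by (rule range_eqI[of _ _ "map (\<lambda>i. r i k) [0..<n]"], rule eq_vecI) simp_all
    have Vc: "V k \<in> carrier_vec n" for k by (simp add: V_def)
    have Vi: "(\<lambda>k. V k $ i) \<longlonglongrightarrow> v $ i" if "i < n" for i
      using r[of i] that by (simp add: V_def)
    have "(\<lambda>k. \<Sum>i<n. \<Sum>j<n. V k $ i * A $$ (i, j) * V k $ j)
        \<longlonglongrightarrow> (\<Sum>i<n. \<Sum>j<n. v $ i * A $$ (i, j) * v $ j)"
      by (intro tendsto_sum tendsto_mult tendsto_const Vi) simp_all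
    then have lim1: "(\<lambda>k. qform A (V k)) \<longlonglongrightarrow> qform A v"
      unfolding qform_eq_sum[OF A v] qform_eq_sum[OF A Vc] .
    have sp: "scalar_prod w w = (\<Sum>i<n. w $ i * w $ i)" if "w \<in> carrier_vec n" for w :: "real vec"
      using that by (simp add: scalar_prod_def atLeast0LessThan)
    have lim2: "(\<lambda>k. c * scalar_prod (V k) (V k)) \<longlonglongrightarrow> c * scalar_prod v v"
      unfolding sp[OF v] sp[OF Vc]
      by (intro tendsto_sum tendsto_mult tendsto_const Vi) simp_all
    have "qform A (V k) \<le> c * scalar_prod (V k) (V k)" for k
      using rat V by blast
    then show "qform A v \<le> c * scalar_prod v v"
      by (intro LIMSEQ_le[OF lim1 lim2] exI[of _ 0] allI impI)
  qed
qed (use rat_vecs_carrier[of n] in blast)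

text \<open>By the variational form, each sublevel set is a countable intersection of sets cut out
  by polynomials of degree one in the entries.\<close>

lemma borel_measurable_Max_eigenvalue:
  assumes n: "n > 0" and A: "\<And>w. w \<in> space M \<Longrightarrow> sym_mat n (A w)"
    and meas: "\<And>i j. i < n \<Longrightarrow> j < n \<Longrightarrow> (\<lambda>w. A w $$ (i, j)) \<in> borel_measurable M"
  shows "(\<lambda>w. Max {e. eigenvalue (A w) e}) \<in> borel_measurable M"
  unfolding borel_measurable_iff_le
proof
  fix c
  have "{w \<in> space M. Max {e. eigenvalue (A w) e} \<le> c} =
      {w \<in> space M. \<forall>v\<in>rat_vecs n. (\<Sum>i<n. \<Sum>j<n. v $ i * A w $$ (i, j) * v $ j) \<le> c * scalar_prod v v}"
    (is "{w \<in> space M. ?P w} = {w \<in> space M. ?Q w}")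
  proof (rule Collect_cong, rule conj_cong[OF refl])
    fix w assume "w \<in> space M"
    then have w: "sym_mat n (A w)" by (rule A)
    have "qform (A w) v = (\<Sum>i<n. \<Sum>j<n. v $ i * A w $$ (i, j) * v $ j)" if "v \<in> rat_vecs n" for v
      using that rat_vecs_carrier by (intro qform_eq_sum sym_mat_carrier[OF w]) auto
    then show "?P w \<longleftrightarrow> ?Q w"
      unfolding Max_eigenvalue_le_iff[OF w n] qform_le_iff_rat_vecs[OF sym_mat_carrier[OF w]]
      by simp
  qed
  also have "\<dots> \<in> sets M"
  proof (rule sets.sets_Collect_countable_All'[OF _ countable_rat_vecs])
    fix v :: "real vec"
    have [measurable]: "(\<lambda>w. \<Sum>i<n. \<Sum>j<n. v $ i * A w $$ (i, j) * v $ j) \<in> borel_measurable M"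
      by (intro borel_measurable_sum borel_measurable_times meas) auto
    show "{w \<in> space M. (\<Sum>i<n. \<Sum>j<n. v $ i * A w $$ (i, j) * v $ j) \<le> c * scalar_prod v v} \<in> sets M"
      by measurable
  qed
  finally show "{w \<in> space M. Max {e. eigenvalue (A w) e} \<le> c} \<in> sets M" .
qed

lemma borel_measurable_cond_num:
  assumes n: "n > 0" and A: "\<And>w. w \<in> space M \<Longrightarrow> sym_mat n (A w)"
    and meas: "\<And>i j. i < n \<Longrightarrow> j < n \<Longrightarrow> (\<lambda>w. A w $$ (i, j)) \<in> borel_measurable M"
  shows "(\<lambda>w. cond_num (A w)) \<in> borel_measurable M"
proof -
  have max_A: "(\<lambda>w. Max {e. eigenvalue (A w) e}) \<in> borel_measurable M"
    by (rule borel_measurable_Max_eigenvalue[OF n A meas])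
  have "(\<lambda>w. (- A w) $$ (i, j)) \<in> borel_measurable M" if "i < n" "j < n" for i j
  proof -
    have eq: "(- A w) $$ (i, j) = - (A w $$ (i, j))" if "w \<in> space M" for w
      using sym_mat_carrier[OF A[OF that]] \<open>i < n\<close> \<open>j < n\<close> by auto
    have "(\<lambda>w. - (A w $$ (i, j))) \<in> borel_measurable M"
      using meas[OF that] by (rule borel_measurable_uminus)
    then show ?thesis by (subst measurable_cong[OF eq])
  qed
  then have max_neg: "(\<lambda>w. Max {e. eigenvalue (- A w) e}) \<in> borel_measurable M"
    using A by (intro borel_measurable_Max_eigenvalue[OF n]) (auto intro: sym_mat_uminus)
  have meas_q: "(\<lambda>w. Max {e. eigenvalue (A w) e} / - Max {e. eigenvalue (- A w) e}) \<in> borel_measurable M"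
    by (intro borel_measurable_divide borel_measurable_uminus max_A max_neg)
  have eq: "cond_num (A w) = Max {e. eigenvalue (A w) e} / - Max {e. eigenvalue (- A w) e}"
    if "w \<in> space M" for w
    unfolding cond_num_def Min_eigenvalue_eq[OF A[OF that] n] ..
  show ?thesis by (subst measurable_cong[OF eq]) (assumption | rule meas_q)+
qed

section \<open>Condition number of a kernel Hessian\<close>

lemma smult_mat_mult_vec:
  fixes M :: "real mat"
  assumes "M \<in> carrier_mat n n" "v \<in> carrier_vec n"
  shows "(c \<cdot>\<^sub>m M) *\<^sub>v v = c \<cdot>\<^sub>v (M *\<^sub>v v)"
  using assms by (intro eq_vecI) (simp_all add: scalar_prod_def sum_distrib_left mult.assoc)

lemma mat_diag_mult_vec:
  fixes d :: "nat \<Rightarrow> real"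
  assumes "u \<in> carrier_vec n" "p < n"
  shows "(mat_diag n d *\<^sub>v u) $ p = d p * u $ p"
proof -
  have "(mat_diag n d *\<^sub>v u) $ p = (\<Sum>q<n. (if p = q then d q else 0) * u $ q)"
    using assms by (simp add: mat_diag_def scalar_prod_def atLeast0LessThan)
  also have "\<dots> = (\<Sum>q<n. if p = q then d q * u $ q else 0)"
    by (intro sum.cong) auto
  finally show ?thesis using assms by simp
qed

text \<open>The deterministic setting for one fixed sample: \<open>K\<close> stands for the Gram
  matrix, \<open>d\<close> for the curvatures at the sample points, \<open>l\<close> for the
  regularization parameter and \<open>a\<close> for the lower bound on the kernel.\<close>

locale kernel_hessian =
  fixes n :: nat and K :: "real mat" and d :: "nat \<Rightarrow> real" and l a :: real
  assumes n: "n > 0" and K: "sym_mat n K" and d: "\<And>i. i < n \<Longrightarrow> 0 \<le> d i" and l: "l > 0" and a: "a > 0"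
    and K_ge: "\<And>i j. i < n \<Longrightarrow> j < n \<Longrightarrow> a \<le> K $$ (i, j)"
    and K_le: "\<And>i j. i < n \<Longrightarrow> j < n \<Longrightarrow> K $$ (i, j) \<le> 1"
    and K_pd: "pos_def_mat K"
begin

definition Hess :: "real mat" where
  "Hess = (1 / real n) \<cdot>\<^sub>m (K * mat_diag n d * K) + l \<cdot>\<^sub>m K"

definition T :: real where
  "T = Max (d ` {..<n})"

lemma Kc: "K \<in> carrier_mat n n"
  using K by (rule sym_mat_carrier)

lemma Hess_carrier: "Hess \<in> carrier_mat n n"
  using Kc by (auto simp: Hess_def)

lemma mult_K: "v \<in> carrier_vec n \<Longrightarrow> i < n \<Longrightarrow> (K *\<^sub>v v) $ i = (\<Sum>j<n. K $$ (i, j) * v $ j)"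
  using Kc by (simp add: scalar_prod_def atLeast0LessThan)

lemma Hess_entry:
  assumes "i < n" "j < n"
  shows "Hess $$ (i, j) = (1 / real n) * (\<Sum>p<n. K $$ (i, p) * d p * K $$ (p, j)) + l * K $$ (i, j)"
  using Kc assms
  by (simp add: Hess_def mat_diag_mult_right[OF Kc] scalar_prod_def atLeast0LessThan)

lemma K_entry_sym: "i < n \<Longrightarrow> j < n \<Longrightarrow> K $$ (i, j) = K $$ (j, i)"
  using K by (auto simp: sym_mat_iff)

lemma Hess_sym: "sym_mat n Hess"
  unfolding sym_mat_iff
proof (intro conjI allI impI Hess_carrier)
  fix i j assume ij: "i < n" "j < n"
  have "(\<Sum>p<n. K $$ (i, p) * d p * K $$ (p, j)) = (\<Sum>p<n. K $$ (j, p) * d p * K $$ (p, i))"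
    using ij by (intro sum.cong refl) (auto simp: K_entry_sym[of i] K_entry_sym[of _ j])
  then show "Hess $$ (i, j) = Hess $$ (j, i)"
    using ij by (simp add: Hess_entry K_entry_sym[of i j])
qed

text \<open>Symmetry moves the outer factor \<open>K\<close> across the scalar product:
  \<open><v, K D K v> = <K v, D K v>\<close>.\<close>

lemma qform_Hess:
  assumes v: "v \<in> carrier_vec n"
  shows "qform Hess v = (1 / real n) * (\<Sum>p<n. d p * ((K *\<^sub>v v) $ p)\<^sup>2) + l * qform K v"
proof -
  let ?D = "mat_diag n d"
  let ?u = "K *\<^sub>v v"
  have u: "?u \<in> carrier_vec n" "?D *\<^sub>v ?u \<in> carrier_vec n"
    using Kc v by (auto intro!: mult_mat_vec_carrier[of _ n n])
  have Du: "(?D *\<^sub>v ?u) $ p = d p * ?u $ p" if "p < n" for p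
    using mat_diag_mult_vec[OF u(1) that] .
  have KDK: "K * ?D * K \<in> carrier_mat n n"
    by (rule mult_carrier_mat[OF mult_carrier_mat[OF Kc mat_diag_dim] Kc])
  have "K * ?D * K *\<^sub>v v = K *\<^sub>v (?D *\<^sub>v ?u)"
  proof -
    have "K * ?D * K *\<^sub>v v = K * ?D *\<^sub>v ?u"
      using Kc v by (intro assoc_mult_mat_vec[of _ n n _ n]) auto
    also have "\<dots> = K *\<^sub>v (?D *\<^sub>v ?u)"
      using Kc u by (intro assoc_mult_mat_vec[of _ n n _ n]) auto
    finally show ?thesis .
  qed
  moreover have "Hess *\<^sub>v v = ((1 / real n) \<cdot>\<^sub>m (K * ?D * K)) *\<^sub>v v + (l \<cdot>\<^sub>m K) *\<^sub>v v"
    unfolding Hess_def using Kc v KDK by (intro add_mult_distrib_mat_vec[of _ n n]) auto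
  ultimately have "Hess *\<^sub>v v = (1 / real n) \<cdot>\<^sub>v (K *\<^sub>v (?D *\<^sub>v ?u)) + l \<cdot>\<^sub>v ?u"
    using smult_mat_mult_vec[OF KDK v] smult_mat_mult_vec[OF Kc v] by simp
  then have "qform Hess v = (1 / real n) * scalar_prod v (K *\<^sub>v (?D *\<^sub>v ?u)) + l * qform K v"
    using Kc v u by (simp add: qform_def scalar_prod_add_distrib[of _ n])
  also have "scalar_prod v (K *\<^sub>v (?D *\<^sub>v ?u)) = scalar_prod (?D *\<^sub>v ?u) ?u"
    using sym_mat_scalar_prod_swap[OF K v u(2)] .
  also have "\<dots> = (\<Sum>p<n. (?D *\<^sub>v ?u) $ p * ?u $ p)"
    using Kc by (simp add: scalar_prod_def atLeast0LessThan del: index_mult_mat_vec)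
  also have "\<dots> = (\<Sum>p<n. d p * (?u $ p)\<^sup>2)"
    by (intro sum.cong) (auto simp: Du power2_eq_square)
  finally show ?thesis .
qed

lemma qform_K_pos: "v \<in> carrier_vec n \<Longrightarrow> v \<noteq> 0\<^sub>v n \<Longrightarrow> 0 < qform K v"
  using K_pd Kc by (auto simp: pos_def_mat_def qform_def)

lemma qform_K_nonneg:
  assumes "v \<in> carrier_vec n" shows "0 \<le> qform K v"
proof (cases "v = 0\<^sub>v n")
  case True
  then show ?thesis using Kc by (simp add: qform_def)
qed (use qform_K_pos[OF assms] in auto)

text \<open>The entries lie between 0 and 1, so the form is at most the square of the sum of
  \<open>|v_i|\<close>, to which Cauchy-Schwarz applies.\<close>

lemma qform_K_le:
  assumes v: "v \<in> carrier_vec n"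
  shows "qform K v \<le> real n * scalar_prod v v"
proof -
  have "qform K v \<le> (\<Sum>i<n. \<Sum>j<n. \<bar>v $ i\<bar> * \<bar>v $ j\<bar>)"
    unfolding qform_eq_sum[OF Kc v]
  proof (intro sum_mono)
    fix i j assume ij: "i \<in> {..<n}" "j \<in> {..<n}"
    have "v $ i * K $$ (i, j) * v $ j \<le> \<bar>v $ i * v $ j\<bar> * \<bar>K $$ (i, j)\<bar>"
      using abs_ge_self[of "v $ i * K $$ (i, j) * v $ j"] by (simp add: abs_mult mult.commute mult.left_commute)
    also have "\<dots> \<le> \<bar>v $ i * v $ j\<bar> * 1"
      using ij a K_ge[of i j] K_le[of i j] by (intro mult_left_mono) auto
    finally show "v $ i * K $$ (i, j) * v $ j \<le> \<bar>v $ i\<bar> * \<bar>v $ j\<bar>" by (simp add: abs_mult)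
  qed
  also have "\<dots> = (\<Sum>i<n. 1 * \<bar>v $ i\<bar>)\<^sup>2"
    by (simp add: power2_eq_square sum_product)
  also have "\<dots> \<le> (\<Sum>i<n. 1\<^sup>2) * (\<Sum>i<n. \<bar>v $ i\<bar>\<^sup>2)"
    by (rule Cauchy_Schwarz_ineq_sum)
  also have "\<dots> = real n * scalar_prod v v"
    using v by (simp add: scalar_prod_def atLeast0LessThan power2_eq_square)
  finally show ?thesis .
qed

lemma d_le_T: "i < n \<Longrightarrow> d i \<le> T"
  by (simp add: T_def)

lemma T_attained: obtains p where "p < n" "d p = T"
proof -
  have "T \<in> d ` {..<n}" unfolding T_def using n by (intro Max_in) auto
  then show thesis using that by (elim imageE) simp
qed

lemma T_nonneg: "0 \<le> T"
proof -
  obtain p where "p < n" "d p = T" by (rule T_attained)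
  then show ?thesis using d[of p] by simp
qed

text \<open>Replacing each curvature by \<open>T\<close> leaves \<open>T |K v|^2 / n\<close>. As
  \<open>K\<close> lies between 0 and \<open>n I\<close>, \<open>|K v|^2 \<le> n <v, K v>\<close>,
  and the factor \<open>n\<close> cancels.\<close>

lemma qform_Hess_le:
  assumes v: "v \<in> carrier_vec n"
  shows "qform Hess v \<le> (T + l) * qform K v"
proof -
  let ?u = "K *\<^sub>v v"
  have "(\<Sum>p<n. d p * (?u $ p)\<^sup>2) \<le> (\<Sum>p<n. T * (?u $ p)\<^sup>2)"
    by (intro sum_mono mult_right_mono) (auto simp: d_le_T)
  also have "\<dots> = T * scalar_prod ?u ?u"
    using Kc by (simp add: scalar_prod_def[of ?u] atLeast0LessThan sum_distrib_left power2_eq_square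
        del: index_mult_mat_vec)
  also have "\<dots> \<le> T * (real n * qform K v)"
    using n psd_mult_mat_vec_sq_le[OF K v _ qform_K_nonneg qform_K_le]
    by (intro mult_left_mono T_nonneg) simp
  finally have "(1 / real n) * (\<Sum>p<n. d p * (?u $ p)\<^sup>2) \<le> T * qform K v"
    using n by (simp add: field_simps)
  then show ?thesis by (simp add: qform_Hess[OF v] algebra_simps)
qed

lemma qform_Hess_ge:
  assumes v: "v \<in> carrier_vec n"
  shows "l * qform K v \<le> qform Hess v"
proof -
  have "0 \<le> (\<Sum>p<n. d p * ((K *\<^sub>v v) $ p)\<^sup>2)"
    using d by (intro sum_nonneg mult_nonneg_nonneg) auto
  then show ?thesis by (simp add: qform_Hess[OF v])
qed

abbreviation "lmax A \<equiv> Max {e. eigenvalue A e}"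
abbreviation "lmin A \<equiv> Min {e. eigenvalue A e}"

text \<open>For the all-ones vector every coordinate of \<open>K v\<close> is at least
  \<open>n a\<close>. The summand of maximal curvature alone contributes \<open>n a^2 T\<close>, to
  be compared with \<open>|v|^2 = n\<close>.\<close>

lemma Max_eigenvalue_Hess_ge: "a\<^sup>2 * T \<le> lmax Hess"
proof -
  obtain p where p: "p < n" "d p = T" by (rule T_attained)
  define v :: "real vec" where "v = vec n (\<lambda>_. 1)"
  have v: "v \<in> carrier_vec n" by (simp add: v_def)
  have vv: "scalar_prod v v = real n" by (simp add: v_def scalar_prod_def)
  have "real n * a = (\<Sum>j<n. a)" by simp
  also have "\<dots> \<le> (K *\<^sub>v v) $ p"
    unfolding mult_K[OF v p(1)] using p K_ge by (intro sum_mono) (auto simp: v_def)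
  finally have "(real n * a)\<^sup>2 \<le> ((K *\<^sub>v v) $ p)\<^sup>2" using a by (intro power_mono) auto
  then have "T * (real n * a)\<^sup>2 \<le> d p * ((K *\<^sub>v v) $ p)\<^sup>2"
    unfolding p(2) by (rule mult_left_mono[OF _ T_nonneg])
  also have "\<dots> \<le> (\<Sum>p<n. d p * ((K *\<^sub>v v) $ p)\<^sup>2)"
    using p d by (intro member_le_sum) auto
  finally have *: "(1 / real n) * (T * (real n * a)\<^sup>2) \<le> (1 / real n) * (\<Sum>p<n. d p * ((K *\<^sub>v v) $ p)\<^sup>2)"
    by (intro mult_left_mono) auto
  have "real n * (a\<^sup>2 * T) \<le> qform Hess v"
  proof -
    have "(1 / real n) * (T * (real n * a)\<^sup>2) = real n * (a\<^sup>2 * T)"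
      using n by (simp add: power2_eq_square)
    moreover have "0 \<le> l * qform K v" using l qform_K_nonneg[OF v] by simp
    ultimately show ?thesis unfolding qform_Hess[OF v] using * by linarith
  qed
  also have "\<dots> \<le> lmax Hess * real n"
    using bspec[OF iffD1[OF Max_eigenvalue_le_iff[OF Hess_sym n] order_refl] v] unfolding vv .
  finally show ?thesis using n by (simp add: mult.commute)
qed

text \<open>The first unit vector picks out a diagonal entry of the Hessian, where the products of
  entries of \<open>K\<close> are at most 1.\<close>

lemma Min_eigenvalue_Hess_le: "lmin Hess \<le> (\<Sum>p<n. d p) / real n + l"
proof -
  have "lmin Hess \<le> qform Hess (unit_vec n 0)"
    using bspec[OF iffD1[OF le_Min_eigenvalue_iff[OF Hess_sym n] order_refl], of "unit_vec n 0"] n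
    by simp
  also have "\<dots> = Hess $$ (0, 0)"
    using n Hess_carrier by (simp add: qform_def)
  also have "\<dots> \<le> (1 / real n) * (\<Sum>p<n. d p) + l"
  proof -
    have le: "K $$ (0, p) * d p * K $$ (p, 0) \<le> d p" if "p < n" for p
    proof -
      have "K $$ (0, p) * K $$ (p, 0) \<le> 1"
        using K_ge[of 0 p] K_ge[of p 0] K_le[of 0 p] K_le[of p 0] n that a by (intro mult_le_one) auto
      from mult_left_mono[OF this d[OF that]] show ?thesis
        by (simp add: mult.assoc mult.left_commute)
    qed
    have "l * K $$ (0, 0) \<le> l" using K_le[of 0 0] n l by simp
    moreover have "(1 / real n) * (\<Sum>p<n. K $$ (0, p) * d p * K $$ (p, 0)) \<le> (1 / real n) * (\<Sum>p<n. d p)"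
      using le by (intro mult_left_mono sum_mono) auto
    ultimately show ?thesis unfolding Hess_entry[OF n n] by linarith
  qed
  finally show ?thesis by simp
qed

lemma Min_eigenvalue_K_pos: "0 < lmin K"
proof -
  have "{e. eigenvalue K e} \<noteq> {}" using ex_max_eigenvalue[OF K n] by auto
  then have "eigenvalue K (lmin K)" using Min_in[OF finite_eigenvalues[OF Kc]] by auto
  then obtain v where v: "v \<in> carrier_vec n" "scalar_prod v v > 0" "qform K v = lmin K * scalar_prod v v"
    by (rule eigenvalue_qform[OF Kc])
  then have "v \<noteq> 0\<^sub>v n" by auto
  then show ?thesis using qform_K_pos[OF v(1)] v by (simp add: zero_less_mult_iff)
qed

lemma Max_eigenvalue_Hess_le: "lmax Hess \<le> (T + l) * lmax K"
  unfolding Max_eigenvalue_le_iff[OF Hess_sym n]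
proof
  fix v :: "real vec" assume v: "v \<in> carrier_vec n"
  have "qform K v \<le> lmax K * scalar_prod v v"
    using bspec[OF iffD1[OF Max_eigenvalue_le_iff[OF K n] order_refl] v] .
  then have "(T + l) * qform K v \<le> (T + l) * (lmax K * scalar_prod v v)"
    using T_nonneg l by (intro mult_left_mono) auto
  then show "qform Hess v \<le> (T + l) * lmax K * scalar_prod v v"
    using qform_Hess_le[OF v] by (simp add: mult.assoc)
qed

lemma Min_eigenvalue_Hess_ge: "l * lmin K \<le> lmin Hess"
  unfolding le_Min_eigenvalue_iff[OF Hess_sym n]
proof
  fix v :: "real vec" assume v: "v \<in> carrier_vec n"
  have "lmin K * scalar_prod v v \<le> qform K v"
    using bspec[OF iffD1[OF le_Min_eigenvalue_iff[OF K n] order_refl] v] .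
  then have "l * (lmin K * scalar_prod v v) \<le> l * qform K v"
    using l by (intro mult_left_mono) auto
  then show "l * lmin K * scalar_prod v v \<le> qform Hess v"
    using qform_Hess_ge[OF v] by (simp add: mult.assoc)
qed

lemma Max_eigenvalue_K_nonneg: "0 \<le> lmax K"
proof -
  obtain e where "eigenvalue K e" by (rule ex_max_eigenvalue[OF K n])
  then have "lmin K \<le> e" "e \<le> lmax K" using finite_eigenvalues[OF Kc] by auto
  then show ?thesis using Min_eigenvalue_K_pos by linarith
qed

lemma cond_num_K_nonneg: "0 \<le> cond_num K"
  using Max_eigenvalue_K_nonneg Min_eigenvalue_K_pos by (simp add: cond_num_def)

lemma cond_num_Hess_le: "cond_num Hess \<le> cond_num K * (1 + T / l)"
proof -
  have pos: "0 < l * lmin K" using l Min_eigenvalue_K_pos by simp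
  have "cond_num Hess \<le> ((T + l) * lmax K) / (l * lmin K)"
    unfolding cond_num_def
    using pos Max_eigenvalue_Hess_le Min_eigenvalue_Hess_ge T_nonneg l Max_eigenvalue_K_nonneg
    by (intro frac_le) auto
  also have "\<dots> = lmax K / lmin K * ((T + l) / l)"
    by (simp add: mult.commute)
  also have "\<dots> = cond_num K * (1 + T / l)"
    using l by (simp add: cond_num_def add_divide_distrib add.commute)
  finally show ?thesis .
qed

lemma cond_num_Hess_ge: "a\<^sup>2 * T / ((\<Sum>p<n. d p) / real n + l) \<le> cond_num Hess"
proof -
  have "0 < l * lmin K" using l Min_eigenvalue_K_pos by simp
  \<comment> \<open>Comparing the quotients needs a positive denominator, which comes from the
    positive definiteness of \<open>K\<close>.\<close>
  then have pos: "0 < lmin Hess" using Min_eigenvalue_Hess_ge by linarith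
  have "0 \<le> lmax Hess" using Max_eigenvalue_Hess_ge mult_nonneg_nonneg[OF zero_le_power2[of a] T_nonneg]
    by linarith
  then show ?thesis
    unfolding cond_num_def
    using pos Max_eigenvalue_Hess_ge Min_eigenvalue_Hess_le
    by (intro frac_le) auto
qed

end

section \<open>The kernel minimizer\<close>

context rkhs begin

text \<open>The reproducing property writes \<open>k x y\<close> as the inner product of two kernel
  sections.\<close>

lemma kernel_sym: "k x y = k y x"
  using reproducing[OF kernel_mem, of y x] reproducing[OF kernel_mem, of x y]
    ip_sym[OF kernel_mem kernel_mem, of x y] by simp

lemma sum_mem:
  fixes n :: nat
  assumes "\<And>i. i < n \<Longrightarrow> f i \<in> H"
  shows "(\<lambda>z. \<Sum>i<n. f i z) \<in> H"
  using assms
proof (induction n)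
  case 0
  show ?case using zero_mem by simp
next
  case (Suc n)
  have "(\<lambda>z. (\<Sum>i<n. f i z) + f n z) \<in> H"
    using Suc by (intro add_mem) auto
  then show ?case by simp
qed

lemma kernel_model_mem:
  assumes "w \<in> kernel_model k l n m x y"
  shows "w \<in> H"
proof -
  obtain \<alpha> where w: "w = (\<lambda>z. (\<Sum>i<n. \<alpha> i * k z (x i)) + 1 / (real m * l) * (\<Sum>j<m. k z (y j)))"
    using assms by (auto simp: kernel_model_def)
  show ?thesis unfolding w by (intro add_mem scale_mem sum_mem kernel_mem)
qed

lemma ip_add_right: "f \<in> H \<Longrightarrow> g \<in> H \<Longrightarrow> h \<in> H \<Longrightarrow> ip h (\<lambda>z. f z + g z) = ip h f + ip h g"
  using ip_add[of f g h] ip_sym[of h f] ip_sym[of h g] ip_sym[of h "\<lambda>z. f z + g z"] add_mem[of f g]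
  by simp

lemma ip_scale_right: "f \<in> H \<Longrightarrow> g \<in> H \<Longrightarrow> ip g (\<lambda>z. c * f z) = c * ip g f"
  using ip_scale[of f g c] ip_sym[of g f] ip_sym[of g "\<lambda>z. c * f z"] scale_mem[of f c]
  by simp

lemma ip_lincomb:
  assumes "f \<in> H" "g \<in> H"
  shows "ip (\<lambda>z. a * f z + b * g z) (\<lambda>z. a * f z + b * g z) =
    a\<^sup>2 * ip f f + 2 * a * b * ip f g + b\<^sup>2 * ip g g"
  using assms ip_sym[OF assms]
  by (simp add: ip_add ip_add_right ip_scale ip_scale_right add_mem scale_mem power2_eq_square
      algebra_simps)

lemma rkhs_norm_sq: "f \<in> H \<Longrightarrow> (rkhs_norm ip f)\<^sup>2 = ip f f"
  by (simp add: rkhs_norm_def ip_nonneg)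

text \<open>The model is an affine space: the coefficients of the \<open>y\<close> part are fixed,
  and weights summing to 1 preserve them.\<close>

lemma kernel_model_midpoint:
  assumes "u \<in> kernel_model k l n m x y" "v \<in> kernel_model k l n m x y"
  shows "(\<lambda>z. 1/2 * u z + 1/2 * v z) \<in> kernel_model k l n m x y"
proof -
  obtain \<alpha> \<beta>
    where u: "u = (\<lambda>z. (\<Sum>i<n. \<alpha> i * k z (x i)) + 1 / (real m * l) * (\<Sum>j<m. k z (y j)))"
      and v: "v = (\<lambda>z. (\<Sum>i<n. \<beta> i * k z (x i)) + 1 / (real m * l) * (\<Sum>j<m. k z (y j)))"
    using assms by (auto simp: kernel_model_def)
  have "1/2 * u z + 1/2 * v z =
      (\<Sum>i<n. ((\<alpha> i + \<beta> i) / 2) * k z (x i)) + 1 / (real m * l) * (\<Sum>j<m. k z (y j))" for z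
  proof -
    have "(\<Sum>i<n. ((\<alpha> i + \<beta> i) / 2) * k z (x i)) =
        (\<Sum>i<n. 1/2 * (\<alpha> i * k z (x i)) + 1/2 * (\<beta> i * k z (x i)))"
      by (intro sum.cong refl) (simp add: field_simps)
    also have "\<dots> = 1/2 * (\<Sum>i<n. \<alpha> i * k z (x i)) + 1/2 * (\<Sum>i<n. \<beta> i * k z (x i))"
      by (simp only: sum.distrib sum_distrib_left)
    finally have eq: "(\<Sum>i<n. ((\<alpha> i + \<beta> i) / 2) * k z (x i)) =
      1/2 * (\<Sum>i<n. \<alpha> i * k z (x i)) + 1/2 * (\<Sum>i<n. \<beta> i * k z (x i))" .
    show ?thesis unfolding u v eq by (simp only: distrib_left) simp
  qed
  then show ?thesis
    unfolding kernel_model_def by (intro CollectI exI[of _ "\<lambda>i. (\<alpha> i + \<beta> i) / 2"] ext)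
qed

text \<open>The parallelogram law makes the ridge term strictly midpoint convex.\<close>

lemma objective_midpoint:
  assumes psi: "convex_on UNIV \<psi>" and uv: "u \<in> H" "v \<in> H"
  shows "objective \<psi> ip l n m x y (\<lambda>z. 1/2 * u z + 1/2 * v z) \<le>
    1/2 * objective \<psi> ip l n m x y u + 1/2 * objective \<psi> ip l n m x y v
      - l / 8 * ip (\<lambda>z. 1 * u z + - 1 * v z) (\<lambda>z. 1 * u z + - 1 * v z)"
proof -
  let ?w = "\<lambda>z. 1/2 * u z + 1/2 * v z"
  have "\<psi> (?w z) \<le> 1/2 * \<psi> (u z) + 1/2 * \<psi> (v z)" for z
    using convex_onD[OF psi, of "1/2" "u z" "v z"] by simp
  then have "(\<Sum>i<n. \<psi> (?w (x i))) \<le> (\<Sum>i<n. 1/2 * \<psi> (u (x i)) + 1/2 * \<psi> (v (x i)))"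
    by (intro sum_mono)
  also have "\<dots> = 1/2 * (\<Sum>i<n. \<psi> (u (x i))) + 1/2 * (\<Sum>i<n. \<psi> (v (x i)))"
    by (simp only: sum.distrib sum_distrib_left)
  finally have 1: "1 / real n * (\<Sum>i<n. \<psi> (?w (x i))) \<le>
      1 / real n * (1/2 * (\<Sum>i<n. \<psi> (u (x i))) + 1/2 * (\<Sum>i<n. \<psi> (v (x i))))"
    by (rule mult_left_mono) simp
  have 2: "(\<Sum>j<m. ?w (y j)) = 1/2 * (\<Sum>j<m. u (y j)) + 1/2 * (\<Sum>j<m. v (y j))"
    by (simp only: sum.distrib sum_distrib_left)
  have 3: "(rkhs_norm ip ?w)\<^sup>2 = 1/2 * (rkhs_norm ip u)\<^sup>2 + 1/2 * (rkhs_norm ip v)\<^sup>2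
      - 1/4 * ip (\<lambda>z. 1 * u z + - 1 * v z) (\<lambda>z. 1 * u z + - 1 * v z)"
    unfolding ip_lincomb[OF uv] rkhs_norm_sq[OF uv(1)] rkhs_norm_sq[OF uv(2)]
      rkhs_norm_sq[OF add_mem[OF scale_mem[OF uv(1)] scale_mem[OF uv(2)]]]
    by (simp add: power2_eq_square field_simps)
  show ?thesis
    unfolding objective_def 2 3 using 1 by (simp add: algebra_simps)
qed

text \<open>Two minimizers have the same value, and their feasible midpoint cannot do better, so the
  gain in \<open>objective_midpoint\<close> must vanish and with it the norm of the
  difference.\<close>

lemma arg_min_unique:
  assumes psi: "convex_on UNIV \<psi>" and l: "l > 0"
    and u: "is_arg_min (objective \<psi> ip l n m x y) (\<lambda>w. w \<in> kernel_model k l n m x y) u"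
    and v: "is_arg_min (objective \<psi> ip l n m x y) (\<lambda>w. w \<in> kernel_model k l n m x y) v"
  shows "u = v"
proof -
  let ?f = "objective \<psi> ip l n m x y"
  let ?w = "\<lambda>z. 1/2 * u z + 1/2 * v z"
  \<comment> \<open>The difference is written with coefficients \<open>1\<close> and
    \<open>- 1\<close> to match the linear combination in \<open>objective_midpoint\<close>.\<close>
  let ?d = "\<lambda>z. 1 * u z + - 1 * v z"
  have um: "u \<in> kernel_model k l n m x y" "v \<in> kernel_model k l n m x y"
    using u v by (simp_all add: is_arg_min_def)
  have H: "u \<in> H" "v \<in> H" using um by (simp_all add: kernel_model_mem)
  have dH: "?d \<in> H" by (intro add_mem scale_mem H)
  have "\<not> ?f v < ?f u" "\<not> ?f u < ?f v" "\<not> ?f ?w < ?f u"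
    using u v um kernel_model_midpoint[OF um] unfolding is_arg_min_def by blast+
  then have "l / 8 * ip ?d ?d \<le> 0"
    using objective_midpoint[OF psi H, of l n m x y] by linarith
  then have "ip ?d ?d = 0"
    using l ip_nonneg[OF dH] by (simp add: mult_le_0_iff)
  then have "?d = (\<lambda>z. 0)" by (rule ip_definite[OF dH])
  then have "1 * u z + - 1 * v z = 0" for z by (rule fun_cong)
  then show ?thesis by (intro ext) simp
qed

end

section \<open>Invariance of the minimization problem under reordering\<close>

text \<open>Permuting the points is compensated by permuting the coefficients with the inverse. The
  reverse inclusion comes from applying this to the inverse permutation.\<close>

lemma kernel_model_permute_subset:
  assumes p: "p permutes {..<n}" and x': "\<And>j. j < n \<Longrightarrow> x' j = x (p j)"
  shows "kernel_model k l n m x' y \<subseteq> kernel_model k l n m x y"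
proof
  let ?q = "Hilbert_Choice.inv p"
  fix w assume "w \<in> kernel_model k l n m x' y"
  then obtain \<alpha> where w: "w = (\<lambda>z. (\<Sum>i<n. \<alpha> i * k z (x' i)) + 1 / (real m * l) * (\<Sum>j<m. k z (y j)))"
    by (auto simp: kernel_model_def)
  have "(\<Sum>i<n. \<alpha> i * k z (x' i)) = (\<Sum>i<n. \<alpha> (?q i) * k z (x i))" for z
    unfolding sum.permute[OF p, of "\<lambda>i. \<alpha> (?q i) * k z (x i)"]
    by (intro sum.cong refl) (simp add: x' permutes_inverses[OF p])
  then show "w \<in> kernel_model k l n m x y"
    unfolding kernel_model_def w by (intro CollectI exI[of _ "\<lambda>i. \<alpha> (?q i)"]) simp
qed

lemma kernel_model_permute:
  assumes p: "p permutes {..<n}" and x': "\<And>j. j < n \<Longrightarrow> x' j = x (p j)"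
  shows "kernel_model k l n m x' y = kernel_model k l n m x y"
proof
  show "kernel_model k l n m x' y \<subseteq> kernel_model k l n m x y"
    by (rule kernel_model_permute_subset[OF p]) (rule x')
  have "x j = x' (Hilbert_Choice.inv p j)" if "j < n" for j
    using x'[of "Hilbert_Choice.inv p j"] that permutes_in_image[OF permutes_inv[OF p], of j]
      permutes_inverses[OF p] by simp
  then show "kernel_model k l n m x y \<subseteq> kernel_model k l n m x' y"
    by (rule kernel_model_permute_subset[OF permutes_inv[OF p]])
qed

lemma objective_permute:
  assumes p: "p permutes {..<n}" and x': "\<And>j. j < n \<Longrightarrow> x' j = x (p j)"
  shows "objective \<psi> ip l n m x' y = objective \<psi> ip l n m x y"
proof -
  have "(\<Sum>i<n. \<psi> (w (x' i))) = (\<Sum>i<n. \<psi> (w (x i)))" for w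
    unfolding sum.permute[OF p, of "\<lambda>i. \<psi> (w (x i))"]
    by (intro sum.cong refl) (simp add: x')
  then show ?thesis by (simp add: objective_def fun_eq_iff)
qed

section \<open>Sign and measurability of the curvature\<close>

text \<open>Adding the tangent inequalities at two points shows that the first derivative is
  monotone.\<close>

lemma convex_second_deriv_nonneg:
  assumes convex: "convex_on UNIV \<psi>" and d1: "\<And>u. \<psi> differentiable (at u)"
    and d2: "deriv \<psi> differentiable (at u)"
  shows "0 \<le> deriv (deriv \<psi>) (u :: real)"
proof (rule mono_on_imp_deriv_nonneg)
  show "(deriv \<psi> has_real_derivative deriv (deriv \<psi>) u) (at u)"
    using d2 by (simp add: DERIV_deriv_iff_real_differentiable)
  have tangent: "deriv \<psi> c * (x - c) \<le> \<psi> x - \<psi> c" for x c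
    using convex_on_imp_above_tangent[OF convex, of c x "deriv \<psi> c"] d1[of c]
    by (simp add: DERIV_deriv_iff_real_differentiable)
  show "mono_on UNIV (deriv \<psi>)"
  proof (rule mono_onI)
    fix r s :: real assume "r \<le> s"
    moreover have "(deriv \<psi> s - deriv \<psi> r) * (s - r) \<ge> 0"
      using tangent[of r s] tangent[of s r] by (simp add: algebra_simps)
    ultimately show "deriv \<psi> r \<le> deriv \<psi> s"
      by (cases "r = s") (auto simp: zero_le_mult_iff)
  qed
qed simp

text \<open>A derivative may be discontinuous, but it is the pointwise limit of measurable
  difference quotients. Applied to \<open>deriv \<psi>\<close>, this makes the curvatures random
  variables.\<close>

lemma borel_measurable_deriv_real:
  fixes f :: "real \<Rightarrow> real"
  assumes d: "\<And>u. f differentiable (at u)"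
  shows "deriv f \<in> borel_measurable borel"
proof (rule borel_measurable_LIMSEQ_real)
  define h where "h = (\<lambda>n. inverse (real (Suc n)))"
  have [measurable]: "f \<in> borel_measurable borel"
    using d by (intro borel_measurable_continuous_onI continuous_at_imp_continuous_on ballI
        differentiable_imp_continuous_within)
  show "(\<lambda>u. (f (u + h n) - f u) / h n) \<in> borel_measurable borel" for n
    by measurable
  fix u
  have "(\<lambda>t. (f (u + t) - f u) / t) \<midarrow>0\<rightarrow> deriv f u"
    using iffD2[OF DERIV_deriv_iff_real_differentiable d[of u]] unfolding DERIV_def .
  moreover have "h \<longlonglongrightarrow> 0" "\<And>n. h n \<noteq> 0"
    unfolding h_def by (rule LIMSEQ_inverse_real_of_nat) simp
  ultimately show "(\<lambda>n. (f (u + h n) - f u) / h n) \<longlonglongrightarrow> deriv f u"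
    using tendsto_at_iff_sequentially[of "\<lambda>t. (f (u + t) - f u) / t" "deriv f u" 0 UNIV]
    by (auto simp: comp_def)
qed

section \<open>Exchangeability of the curvatures\<close>

text \<open>Only the first sample is reordered; the restriction to indices below \<open>n\<close>
  keeps the result in the extensional product space.\<close>

definition permute_sample ::
    "(nat \<Rightarrow> nat) \<Rightarrow> nat \<Rightarrow> (nat \<Rightarrow> 'z) \<times> (nat \<Rightarrow> 'z) \<Rightarrow> (nat \<Rightarrow> 'z) \<times> (nat \<Rightarrow> 'z)" where
  "permute_sample p n = (\<lambda>(x, y). (\<lambda>j\<in>{..<n}. x (p j), y))"

lemma permute_sample_measurable:
  assumes "p permutes {..<n}"
  shows "permute_sample p n \<in> measurable (sample_law P Q n m) (sample_law P Q n m)"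
proof -
  have "(\<lambda>\<omega>. fst \<omega> (p j)) \<in> measurable (PiM {..<n} (\<lambda>_. P) \<Otimes>\<^sub>M PiM {..<m} (\<lambda>_. Q)) P" if "j < n" for j
  proof -
    have "p j \<in> {..<n}" using permutes_in_image[OF assms, of j] that by simp
    then show ?thesis by measurable
  qed
  then show ?thesis
    unfolding permute_sample_def sample_law_def case_prod_beta'
    by (intro measurable_Pair measurable_restrict measurable_snd) auto
qed

text \<open>A power measure is invariant under permuting coordinates, and the second factor is
  mapped by the identity.\<close>

lemma distr_permute_sample:
  assumes P: "prob_space P" and Q: "prob_space Q" and p: "p permutes {..<n}"
  shows "distr (sample_law P Q n m) (sample_law P Q n m) (permute_sample p n) = sample_law P Q n m"
proof -
  let ?P = "PiM {..<n} (\<lambda>_. P)" and ?Q = "PiM {..<m} (\<lambda>_. Q)"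
  let ?f = "\<lambda>x. \<lambda>j\<in>{..<n}. x (p j)"
  have "inj_on p {..<n}" using p by (metis permutes_inj_on)
  moreover have "p \<in> {..<n} \<rightarrow> {..<n}" using permutes_in_image[OF p] by auto
  ultimately have f: "distr ?P ?P ?f = ?P"
    using distr_PiM_reindex[of "{..<n}" "\<lambda>_. P" p "{..<n}"] P by simp
  have "?f \<in> measurable ?P ?P"
    using permutes_in_image[OF p] by (intro measurable_restrict measurable_component_singleton) auto
  moreover have "sigma_finite_measure (distr ?Q ?Q (\<lambda>y. y))"
    using prob_space_PiM[of "{..<m}" "\<lambda>_. Q"] Q by (simp add: prob_space_imp_sigma_finite)
  ultimately show ?thesis
    using pair_measure_distr[of ?f ?P ?P "\<lambda>y. y" ?Q ?Q]
    by (simp add: sample_law_def permute_sample_def f)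
qed

lemma prob_space_sample_law:
  assumes "prob_space P" "prob_space Q"
  shows "prob_space (sample_law P Q n m)"
  unfolding sample_law_def using assms by (intro prob_space_pair prob_space_PiM)

text \<open>Swapping points 0 and \<open>i\<close> preserves the law and, by uniqueness, almost
  surely the minimizer. Hence the value at point 0 of the swapped sample is the value at point
  \<open>i\<close> of the original one.\<close>

lemma exchangeable_expectation:
  assumes P: "prob_space P" and Q: "prob_space Q" and rkhs: "rkhs H ip k"
    and psi: "convex_on UNIV \<psi>" and l: "l > 0"
    and argmin: "AE (x, y) in sample_law P Q n m.
      is_arg_min (objective \<psi> ip l n m x y) (\<lambda>w. w \<in> kernel_model k l n m x y) (wh x y)"
    and meas: "\<And>i. i < n \<Longrightarrow> (\<lambda>(x, y). \<phi> (wh x y (x i))) \<in> borel_measurable (sample_law P Q n m)"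
    and int: "integrable (sample_law P Q n m) (\<lambda>(x, y). \<phi> (wh x y (x 0)) :: real)"
    and i: "i < n"
  shows "integrable (sample_law P Q n m) (\<lambda>(x, y). \<phi> (wh x y (x i)))"
    and "(\<integral>(x, y). \<phi> (wh x y (x i)) \<partial>sample_law P Q n m) = (\<integral>(x, y). \<phi> (wh x y (x 0)) \<partial>sample_law P Q n m)"
proof -
  let ?L = "sample_law P Q n m"
  let ?p = "Transposition.transpose 0 i"
  let ?R = "permute_sample ?p n"
  let ?g = "\<lambda>i. \<lambda>(x, y). \<phi> (wh x y (x i))"
  let ?good = "\<lambda>(x, y). is_arg_min (objective \<psi> ip l n m x y) (\<lambda>w. w \<in> kernel_model k l n m x y) (wh x y)"
  have n: "0 < n" using i by simp
  have p: "?p permutes {..<n}" using i n by (intro permutes_swap_id) auto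
  note R = permute_sample_measurable[OF p, of P Q m]
  note dR = distr_permute_sample[OF P Q p, of m]
  \<comment> \<open>Invariance of the law shows that the swapped sample, too, almost surely has
    \<open>wh\<close> as a minimizer.\<close>
  have "AE z in distr ?L ?L ?R. ?good z" unfolding dR by (rule argmin)
  then have good: "AE z in ?L. ?good (?R z)" by (rule AE_distrD[OF R])
  have eq: "?g 0 (?R z) = ?g i z" if "?good z" "?good (?R z)" for z
  proof -
    obtain x y where z: "z = (x, y)" by (cases z)
    let ?x = "\<lambda>j\<in>{..<n}. x (?p j)"
    have Rz: "?R (x, y) = (?x, y)" by (simp add: permute_sample_def)
    have obj: "objective \<psi> ip l n m ?x y = objective \<psi> ip l n m x y"
      by (rule objective_permute[OF p]) simp
    have model: "kernel_model k l n m ?x y = kernel_model k l n m x y"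
      by (rule kernel_model_permute[OF p]) simp
    have "is_arg_min (objective \<psi> ip l n m x y) (\<lambda>w. w \<in> kernel_model k l n m x y) (wh ?x y)"
      using that(2) unfolding z Rz prod.case obj model .
    moreover have "is_arg_min (objective \<psi> ip l n m x y) (\<lambda>w. w \<in> kernel_model k l n m x y) (wh x y)"
      using that(1) unfolding z prod.case .
    ultimately have "wh ?x y = wh x y" by (rule rkhs.arg_min_unique[OF rkhs psi l])
    then show ?thesis unfolding z Rz prod.case using n by simp
  qed
  have ae: "AE z in ?L. ?g 0 (?R z) = ?g i z"
    using argmin good by eventually_elim (rule eq)
  have m0: "(\<lambda>z. ?g 0 (?R z)) \<in> borel_measurable ?L"
    by (rule measurable_compose[OF R meas[OF n]])
  have "integrable (distr ?L ?L ?R) (?g 0)" unfolding dR by (rule int)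
  then have "integrable ?L (\<lambda>z. ?g 0 (?R z))"
    by (rule integrable_distr[OF R])
  then show "integrable ?L (?g i)"
    by (rule integrable_cong_AE_imp[OF _ meas[OF i]]) (use ae in eventually_elim, simp)
  have "integral\<^sup>L ?L (?g 0) = integral\<^sup>L (distr ?L ?L ?R) (?g 0)" unfolding dR ..
  also have "\<dots> = (\<integral>z. ?g 0 (?R z) \<partial>?L)" by (rule integral_distr[OF R meas[OF n]])
  also have "\<dots> = integral\<^sup>L ?L (?g i)" by (rule integral_cong_AE[OF m0 meas[OF i] ae])
  finally show "integral\<^sup>L ?L (?g i) = integral\<^sup>L ?L (?g 0)" ..
qed

section \<open>Gram and Hessian matrices of a sample\<close>

lemma gram_mat_carrier: "gram_mat k n x \<in> carrier_mat n n"
  by (simp add: gram_mat_def)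

lemma gram_mat_entry: "i < n \<Longrightarrow> j < n \<Longrightarrow> gram_mat k n x $$ (i, j) = k (x i) (x j)"
  by (simp add: gram_mat_def)

lemma hessian_mat_carrier: "hessian_mat k \<psi> l n x w \<in> carrier_mat n n"
  by (simp add: hessian_mat_def Let_def gram_mat_def)

lemma hessian_mat_entry:
  assumes "i < n" "j < n"
  shows "hessian_mat k \<psi> l n x w $$ (i, j) =
    (1 / real n) * (\<Sum>p<n. k (x i) (x p) * deriv (deriv \<psi>) (w (x p)) * k (x p) (x j)) + l * k (x i) (x j)"
  using assms carrier_matD[OF gram_mat_carrier[of k n x]]
  by (simp add: hessian_mat_def Let_def mat_diag_mult_right[OF gram_mat_carrier] scalar_prod_def
      gram_mat_entry atLeast0LessThan)

lemma sym_mat_gram_mat: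
  assumes "rkhs H ip k"
  shows "sym_mat n (gram_mat k n x)"
  using rkhs.kernel_sym[OF assms] by (auto simp: sym_mat_iff gram_mat_carrier gram_mat_entry)

text \<open>Kernel symmetry gives this for every sample; measurability of the condition number
  requires it on the whole space, not just almost everywhere.\<close>

lemma sym_mat_hessian_mat:
  assumes "rkhs H ip k"
  shows "sym_mat n (hessian_mat k \<psi> l n x w)"
  unfolding sym_mat_iff
proof (intro conjI allI impI hessian_mat_carrier)
  note sym = rkhs.kernel_sym[OF assms]
  fix i j assume "i < n" "j < n"
  moreover have "(\<Sum>p<n. k (x i) (x p) * deriv (deriv \<psi>) (w (x p)) * k (x p) (x j)) =
      (\<Sum>p<n. k (x j) (x p) * deriv (deriv \<psi>) (w (x p)) * k (x p) (x i))"
    by (intro sum.cong refl) (simp add: sym[of "x i"] sym[of _ "x j"])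
  ultimately show "hessian_mat k \<psi> l n x w $$ (i, j) = hessian_mat k \<psi> l n x w $$ (j, i)"
    by (simp add: hessian_mat_entry sym[of "x i" "x j"])
qed

lemma cond_num_hessian_bounds:
  assumes rkhs: "rkhs H ip k" and n: "n > 0" and l: "l > 0" and eps: "\<epsilon> > 0"
    and k: "\<And>z z'. sqrt \<epsilon> \<le> k z z' \<and> k z z' \<le> 1"
    and psi: "\<And>u. 0 \<le> deriv (deriv \<psi>) u"
    and pd: "pos_def_mat (gram_mat k n x)"
  shows "\<epsilon> * max_curv \<psi> n x w / ((\<Sum>p<n. deriv (deriv \<psi>) (w (x p))) / real n + l)
      \<le> cond_num (hessian_mat k \<psi> l n x w)"
    and "cond_num (hessian_mat k \<psi> l n x w) \<le> cond_num (gram_mat k n x) * (1 + max_curv \<psi> n x w / l)"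
    and "0 \<le> cond_num (gram_mat k n x)"
proof -
  interpret kernel_hessian n "gram_mat k n x" "\<lambda>i. deriv (deriv \<psi>) (w (x i))" l "sqrt \<epsilon>"
    using n l eps k psi pd sym_mat_gram_mat[OF rkhs]
    by unfold_locales (auto simp: gram_mat_entry)
  have H: "hessian_mat k \<psi> l n x w = Hess" by (simp add: hessian_mat_def Hess_def Let_def)
  have T: "max_curv \<psi> n x w = T" by (simp add: max_curv_def T_def)
  have eps2: "(sqrt \<epsilon>)\<^sup>2 = \<epsilon>" using eps by simp
  show "\<epsilon> * max_curv \<psi> n x w / ((\<Sum>p<n. deriv (deriv \<psi>) (w (x p))) / real n + l)
      \<le> cond_num (hessian_mat k \<psi> l n x w)"
    unfolding H T using cond_num_Hess_ge unfolding eps2 .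
  show "cond_num (hessian_mat k \<psi> l n x w) \<le> cond_num (gram_mat k n x) * (1 + max_curv \<psi> n x w / l)"
    unfolding H T by (rule cond_num_Hess_le)
  show "0 \<le> cond_num (gram_mat k n x)" by (rule cond_num_K_nonneg)
qed

text \<open>This isolates the conditions on one sample that imply both bounds: maximal curvature
  between \<open>s\<close> and \<open>t\<close>, and mean curvature at most
  \<open>c\<close>.\<close>

lemma cond_num_hessian_event:
  assumes rkhs: "rkhs H ip k" and n: "n > 0" and l: "l > 0" and eps: "\<epsilon> > 0"
    and k: "\<And>z z'. sqrt \<epsilon> \<le> k z z' \<and> k z z' \<le> 1"
    and psi: "\<And>u. 0 \<le> deriv (deriv \<psi>) u"
    and pd: "pos_def_mat (gram_mat k n x)"
    and t: "max_curv \<psi> n x w \<le> t" and s: "s < max_curv \<psi> n x w" "0 < s"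
    and avg: "(\<Sum>p<n. deriv (deriv \<psi>) (w (x p))) / real n \<le> c" and c: "c + l \<le> \<epsilon> * s powr \<nu>"
  shows "s powr (1 - \<nu>) \<le> cond_num (hessian_mat k \<psi> l n x w) \<and>
    cond_num (hessian_mat k \<psi> l n x w) \<le> cond_num (gram_mat k n x) * (1 + t / l)"
proof
  note b = cond_num_hessian_bounds(1,2)[OF rkhs n l eps k psi pd, where w = w]
    cond_num_hessian_bounds(3)[OF rkhs n l eps k psi pd]
  let ?A = "(\<Sum>p<n. deriv (deriv \<psi>) (w (x p))) / real n"
  have A: "0 \<le> ?A" using psi by (intro divide_nonneg_nonneg sum_nonneg) auto
  \<comment> \<open>In this form numerator and denominator can be compared separately:
    \<open>s\<close> is below the maximal curvature, and \<open>?A + l\<close> is at most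
    \<open>\<epsilon> * s powr \<nu>\<close>.\<close>
  have "s powr (1 - \<nu>) = \<epsilon> * s / (\<epsilon> * s powr \<nu>)"
    using s eps by (simp add: powr_diff)
  also have "\<dots> \<le> \<epsilon> * max_curv \<psi> n x w / (?A + l)"
    using s eps A avg c l by (intro frac_le) auto
  also note b(1)
  finally show "s powr (1 - \<nu>) \<le> cond_num (hessian_mat k \<psi> l n x w)" .
  have "max_curv \<psi> n x w / l \<le> t / l" using t l by (intro divide_right_mono) auto
  then have "cond_num (gram_mat k n x) * (1 + max_curv \<psi> n x w / l) \<le> cond_num (gram_mat k n x) * (1 + t / l)"
    using b(3) by (intro mult_left_mono) auto
  with b(2) show "cond_num (hessian_mat k \<psi> l n x w) \<le> cond_num (gram_mat k n x) * (1 + t / l)"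
    by linarith
qed

lemma borel_measurable_gram_entry:
  assumes k: "(\<lambda>(z, z'). k z z') \<in> borel_measurable (Z \<Otimes>\<^sub>M Z)" and P: "sets P = sets Z"
    and ij: "i < n" "j < n"
  shows "(\<lambda>(x, y). k (x i) (x j)) \<in> borel_measurable (sample_law P Q n m)"
proof -
  have comp: "(\<lambda>z. fst z i) \<in> measurable (sample_law P Q n m) Z" if "i < n" for i
  proof -
    have "i \<in> {..<n}" using that by simp
    then have "(\<lambda>z. fst z i) \<in> measurable (sample_law P Q n m) P"
      unfolding sample_law_def by measurable
    then show ?thesis using measurable_cong_sets[OF refl P] by blast
  qed
  have "(\<lambda>z. (fst z i, fst z j)) \<in> measurable (sample_law P Q n m) (Z \<Otimes>\<^sub>M Z)"
    by (intro measurable_Pair comp ij)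
  from measurable_compose[OF this k] show ?thesis by (simp add: case_prod_beta')
qed

section \<open>Growth rates and the probability estimate at a fixed sample size\<close>

text \<open>The level \<open>s powr (\<nu> / 2)\<close> for the mean curvature grows slowly enough
  to stay below \<open>\<epsilon> * s powr \<nu>\<close> after adding a bounded \<open>L\<close>,
  yet tends to infinity, so that the Markov bound in \<open>rate_tendsto\<close> vanishes.\<close>

lemma rate_eventually:
  fixes s :: "nat \<Rightarrow> real"
  assumes s: "filterlim s at_top sequentially" and "0 < \<nu>" "0 < \<epsilon>"
  shows "\<forall>\<^sub>F n in sequentially. s n powr (\<nu> / 2) + L \<le> \<epsilon> * s n powr \<nu>"
proof -
  have "\<forall>\<^sub>F x in at_top. x powr (\<nu> / 2) + L \<le> \<epsilon> * x powr \<nu>"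
    using assms(2,3) by real_asymp
  then show ?thesis using s by (rule eventually_compose_filterlim)
qed

lemma rate_tendsto:
  fixes s :: "nat \<Rightarrow> real"
  assumes s: "filterlim s at_top sequentially" and "0 < \<nu>"
  shows "(\<lambda>n. M / s n powr (\<nu> / 2)) \<longlonglongrightarrow> 0"
proof -
  have "((\<lambda>x. M / x powr (\<nu> / 2)) \<longlongrightarrow> 0) at_top"
    using assms(2) by real_asymp
  then show ?thesis using s by (rule filterlim_compose)
qed

text \<open>A union bound: almost surely, \<open>T \<le> t\<close> implies that \<open>E\<close>
  holds, or \<open>T \<le> s\<close>, or the mean curvature is at least \<open>c\<close>. The last
  case has probability at most \<open>M / c\<close>.\<close>

lemma cond_num_event_probability:
  fixes Z P Q :: "'z measure"
    and wh :: "(nat \<Rightarrow> 'z) \<Rightarrow> (nat \<Rightarrow> 'z) \<Rightarrow> 'z \<Rightarrow> real"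
    and k :: "'z \<Rightarrow> 'z \<Rightarrow> real" and \<psi> :: "real \<Rightarrow> real" and n m :: nat and l s t \<nu> :: real
  defines "L \<equiv> sample_law P Q n m"
  defines "D \<equiv> distr L borel (\<lambda>(x, y). max_curv \<psi> n x (wh x y))"
  defines "E \<equiv> {(x, y) \<in> space L.
        s powr (1 - \<nu>) \<le> cond_num (hessian_mat k \<psi> l n x (wh x y)) \<and>
        cond_num (hessian_mat k \<psi> l n x (wh x y)) \<le> cond_num (gram_mat k n x) * (1 + t / l)}"
  assumes P: "prob_space P" "sets P = sets Z" and Q: "prob_space Q"
    and rkhs: "rkhs H ip k"
    and k_meas: "(\<lambda>(z, z'). k z z') \<in> borel_measurable (Z \<Otimes>\<^sub>M Z)"
    and eps: "\<epsilon> > 0" and k: "\<And>z z'. sqrt \<epsilon> \<le> k z z' \<and> k z z' \<le> 1"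
    and pd: "AE (x, y) in L. pos_def_mat (gram_mat k n x)"
    and psi: "convex_on UNIV \<psi>" "\<And>u. \<psi> differentiable (at u)" "\<And>u. deriv \<psi> differentiable (at u)"
    and l: "l > 0" and n: "n > 0"
    and argmin: "AE (x, y) in L.
      is_arg_min (objective \<psi> ip l n m x y) (\<lambda>w. w \<in> kernel_model k l n m x y) (wh x y)"
    and wh_meas: "\<And>i. i < n \<Longrightarrow> (\<lambda>(x, y). wh x y (x i)) \<in> borel_measurable L"
    and int: "integrable L (\<lambda>(x, y). deriv (deriv \<psi>) (wh x y (x 0)))"
    and mean: "(\<integral>(x, y). deriv (deriv \<psi>) (wh x y (x 0)) \<partial>L) \<le> M"
    and s: "s > 0" and c: "c > 0" "c + l \<le> \<epsilon> * s powr \<nu>"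
  shows "cdf D t - cdf D s - M / c \<le> measure L E"
proof -
  interpret L: prob_space L unfolding L_def by (rule prob_space_sample_law[OF P(1) Q])
  let ?\<phi> = "deriv (deriv \<psi>)"
  define d where "d = (\<lambda>i. \<lambda>(x, y). ?\<phi> (wh x y (x i)))"
  define T where "T = (\<lambda>z. Max ((\<lambda>i. d i z) ` {..<n}))"
  define A where "A z = (\<Sum>i<n. d i z) / real n" for z
  have psi_nonneg: "0 \<le> ?\<phi> u" for u
    using psi by (intro convex_second_deriv_nonneg)
  have phi_meas: "?\<phi> \<in> borel_measurable borel"
    by (rule borel_measurable_deriv_real[OF psi(3)])
  have d_meas: "d i \<in> borel_measurable L" if "i < n" for i
    using measurable_compose[OF wh_meas[OF that] phi_meas] by (simp add: d_def case_prod_beta')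
  have T_eq: "T = (\<lambda>(x, y). max_curv \<psi> n x (wh x y))"
    by (simp add: fun_eq_iff T_def max_curv_def d_def)
  have T_meas: "T \<in> borel_measurable L"
    unfolding T_def by (intro borel_measurable_Max d_meas) auto
  have cdf: "cdf D a = measure L {z \<in> space L. T z \<le> a}" for a
  proof -
    have "cdf D a = measure L (T -` {..a} \<inter> space L)"
      unfolding cdf_def D_def T_eq[symmetric] by (rule measure_distr[OF T_meas]) simp
    also have "T -` {..a} \<inter> space L = {z \<in> space L. T z \<le> a}" by auto
    finally show ?thesis .
  qed

  \<comment> \<open>Exchangeability extends the bound on the mean at the first point to all points,
    hence to the average \<open>A\<close>.\<close>
  have d_int: "integrable L (d i)" and d_mean: "integral\<^sup>L L (d i) \<le> M" if "i < n" for i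
  proof -
    note ex = exchangeable_expectation[OF P(1) Q rkhs psi(1) l argmin[unfolded L_def], of ?\<phi> i]
    have "\<And>i. i < n \<Longrightarrow> (\<lambda>(x, y). ?\<phi> (wh x y (x i))) \<in> borel_measurable (sample_law P Q n m)"
      using d_meas unfolding d_def L_def .
    note ex = ex[OF this int[unfolded L_def] that]
    show "integrable L (d i)" using ex(1) unfolding d_def L_def .
    show "integral\<^sup>L L (d i) \<le> M" using ex(2) mean unfolding d_def L_def by simp
  qed
  have A_int: "integrable L A"
    unfolding A_def using d_int by (intro integrable_divide integrable_sum) auto
  have "integral\<^sup>L L A = (\<Sum>i<n. integral\<^sup>L L (d i)) / real n"
    unfolding A_def using d_int by (simp add: Bochner_Integration.integral_sum)
  also have "\<dots> \<le> (\<Sum>i<n. M) / real n"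
    using d_mean by (intro divide_right_mono sum_mono) auto
  finally have A_mean: "integral\<^sup>L L A \<le> M" using n by simp
  have d_nonneg: "0 \<le> d i z" for i z
    by (simp add: d_def psi_nonneg split: prod.split)
  then have A_nonneg: "0 \<le> A z" for z
    unfolding A_def by (intro divide_nonneg_nonneg sum_nonneg) auto
  have "measure L {z \<in> space L. A z \<ge> c} \<le> integral\<^sup>L L A / c"
    using A_nonneg c(1) by (intro integral_Markov_inequality_measure[OF A_int, of "{}"]) auto
  also have "\<dots> \<le> M / c" using A_mean c(1) by (intro divide_right_mono) auto
  finally have markov: "measure L {z \<in> space L. A z \<ge> c} \<le> M / c" .

  have gram_meas: "(\<lambda>z. k (fst z i) (fst z j)) \<in> borel_measurable L" if "i < n" "j < n" for i j
    using borel_measurable_gram_entry[OF k_meas P(2) that, of Q m]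
    unfolding L_def by (simp add: case_prod_beta')
  \<comment> \<open>Measurability of \<open>E\<close> is essential: \<open>measure\<close> is 0 by
    convention on nonmeasurable sets, and the union bound needs measurable sets.\<close>
  define G where "G z = cond_num (gram_mat k n (fst z))" for z :: "(nat \<Rightarrow> 'z) \<times> (nat \<Rightarrow> 'z)"
  define h where "h z = cond_num (hessian_mat k \<psi> l n (fst z) (wh (fst z) (snd z)))"
    for z :: "(nat \<Rightarrow> 'z) \<times> (nat \<Rightarrow> 'z)"
  have G_meas: "G \<in> borel_measurable L"
    unfolding G_def
    by (rule borel_measurable_cond_num[OF n sym_mat_gram_mat[OF rkhs]])
      (simp add: gram_mat_entry gram_meas)
  have "(\<lambda>z. ?\<phi> (wh (fst z) (snd z) (fst z p))) \<in> borel_measurable L" if "p < n" for p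
    using d_meas[OF that] by (simp add: d_def case_prod_beta')
  then have h_meas: "h \<in> borel_measurable L"
    unfolding h_def
    by (intro borel_measurable_cond_num[OF n sym_mat_hessian_mat[OF rkhs]])
      (simp add: hessian_mat_entry, intro borel_measurable_add borel_measurable_times
        borel_measurable_divide borel_measurable_sum gram_meas borel_measurable_const; simp)
  have E_eq: "E = {z \<in> space L. s powr (1 - \<nu>) \<le> h z \<and> h z \<le> G z * (1 + t / l)}"
    by (auto simp: E_def h_def G_def)
  have E_sets: "E \<in> sets L"
    unfolding E_eq using h_meas G_meas by measurable
  have s_sets: "{z \<in> space L. T z \<le> s} \<in> sets L" using T_meas by measurable
  have A_sets: "{z \<in> space L. A z \<ge> c} \<in> sets L"
    using borel_measurable_integrable[OF A_int] by measurable

  \<comment> \<open>The inclusion is pointwise wherever the Gram matrix is positive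
    definite.\<close>
  have "AE z in L. z \<in> {z \<in> space L. T z \<le> t} \<longrightarrow>
      z \<in> (E \<union> {z \<in> space L. T z \<le> s}) \<union> {z \<in> space L. A z \<ge> c}"
    using pd
  proof eventually_elim
    case (elim z)
    obtain x y where z: "z = (x, y)" by (cases z)
    have pd: "pos_def_mat (gram_mat k n x)" using elim unfolding z prod.case .
    show ?case
    proof (intro impI, rule ccontr)
      assume zt: "z \<in> {z \<in> space L. T z \<le> t}"
      assume nz: "z \<notin> (E \<union> {z \<in> space L. T z \<le> s}) \<union> {z \<in> space L. A z \<ge> c}"
      have "max_curv \<psi> n x (wh x y) \<le> t" "s < max_curv \<psi> n x (wh x y)"
        using zt nz by (auto simp: z T_eq)
      moreover have "(\<Sum>p<n. ?\<phi> (wh x y (x p))) / real n \<le> c"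
        using zt nz by (auto simp: z A_def d_def)
      ultimately have "s powr (1 - \<nu>) \<le> cond_num (hessian_mat k \<psi> l n x (wh x y)) \<and>
          cond_num (hessian_mat k \<psi> l n x (wh x y)) \<le> cond_num (gram_mat k n x) * (1 + t / l)"
        using s c(2) by (intro cond_num_hessian_event[OF rkhs n l eps k psi_nonneg pd]) auto
      then have "z \<in> E" using zt by (simp add: z E_def)
      then show False using nz by simp
    qed
  qed
  then have "measure L {z \<in> space L. T z \<le> t} \<le>
      measure L ((E \<union> {z \<in> space L. T z \<le> s}) \<union> {z \<in> space L. A z \<ge> c})"
    by (rule L.finite_measure_mono_AE) (intro sets.Un E_sets s_sets A_sets)
  also have "\<dots> \<le> measure L (E \<union> {z \<in> space L. T z \<le> s}) + measure L {z \<in> space L. A z \<ge> c}"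
    by (intro measure_Un_le sets.Un E_sets s_sets A_sets)
  also have "measure L (E \<union> {z \<in> space L. T z \<le> s}) \<le> measure L E + measure L {z \<in> space L. T z \<le> s}"
    by (intro measure_Un_le E_sets s_sets)
  finally show ?thesis using markov unfolding cdf by linarith
qed

theorem theorem5:
  fixes Z P Q :: "'z measure"
    and H :: "('z \<Rightarrow> real) set"
    and ip :: "('z \<Rightarrow> real) \<Rightarrow> ('z \<Rightarrow> real) \<Rightarrow> real"
    and k :: "'z \<Rightarrow> 'z \<Rightarrow> real"
    and \<epsilon> M :: real
    and \<psi> :: "real \<Rightarrow> real"
    and m :: "nat \<Rightarrow> nat"
    and lam :: "nat \<Rightarrow> nat \<Rightarrow> real"
    and what :: "nat \<Rightarrow> (nat \<Rightarrow> 'z) \<Rightarrow> (nat \<Rightarrow> 'z) \<Rightarrow> 'z \<Rightarrow> real"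
    and s t :: "nat \<Rightarrow> real"
  defines "law \<equiv> \<lambda>n. sample_law P Q n (m n)"
    and "F \<equiv> \<lambda>n. cdf (distr (sample_law P Q n (m n)) borel (\<lambda>(x, y). max_curv \<psi> n x (what n x y)))"
  assumes space_Z: "space Z = UNIV"
    and P: "prob_space P" "sets P = sets Z"
    and Q: "prob_space Q" "sets Q = sets Z"
    and m_pos: "\<And>n. n \<ge> 1 \<Longrightarrow> m n \<ge> 1"
    and m_lim: "filterlim m at_top sequentially"
    and rkhs: "rkhs H ip k"
    and k_meas: "(\<lambda>(z, z'). k z z') \<in> borel_measurable (Z \<Otimes>\<^sub>M Z)"
    and eps_pos: "\<epsilon> > 0"
    and k_bounds: "\<And>z z'. sqrt \<epsilon> \<le> k z z' \<and> k z z' \<le> 1"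
    and gram_pd: "\<And>n. n \<ge> 1 \<Longrightarrow> AE (x, y) in law n. pos_def_mat (gram_mat k n x)"
    and psi_convex: "convex_on UNIV \<psi>"
    and psi_diff: "\<And>u. \<psi> differentiable (at u)" "\<And>u. deriv \<psi> differentiable (at u)"
    and lam_pos: "\<And>n. n \<ge> 1 \<Longrightarrow> lam n (m n) > 0"
    and what_min: "\<And>n. n \<ge> 1 \<Longrightarrow> AE (x, y) in law n.
          is_arg_min (objective \<psi> ip (lam n (m n)) n (m n) x y)
            (\<lambda>w. w \<in> kernel_model k (lam n (m n)) n (m n) x y) (what n x y)"
    and what_meas: "\<And>n i. i < n \<Longrightarrow> (\<lambda>(x, y). what n x y (x i)) \<in> borel_measurable (law n)"
    and s_lim: "filterlim s at_top sequentially"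
    and F_s: "(\<lambda>n. F n (s n)) \<longlonglongrightarrow> 0"
    and F_t: "(\<lambda>n. F n (t n)) \<longlonglongrightarrow> 1"
    and M_pos: "M > 0"
    and mean_bound: "\<forall>\<^sub>F n in sequentially.
          integrable (law n) (\<lambda>(x, y). deriv (deriv \<psi>) (what n x y (x 0))) \<and>
          (\<integral>(x, y). deriv (deriv \<psi>) (what n x y (x 0)) \<partial>law n) \<le> M"
    and lam_lim: "convergent (\<lambda>n. lam n (m n))"
  shows "\<forall>\<nu>::real. 0 < \<nu> \<and> \<nu> < 1 \<longrightarrow>
    (\<lambda>n. measure (law n) {(x, y) \<in> space (law n).
        s n powr (1 - \<nu>) \<le> cond_num (hessian_mat k \<psi> (lam n (m n)) n x (what n x y)) \<and>
        cond_num (hessian_mat k \<psi> (lam n (m n)) n x (what n x y))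
          \<le> cond_num (gram_mat k n x) * (1 + t n / lam n (m n))}) \<longlonglongrightarrow> 1"
proof (intro allI impI)
  fix \<nu> :: real assume "0 < \<nu> \<and> \<nu> < 1"
  then have nu: "0 < \<nu>" by simp
  let ?E = "\<lambda>n. {(x, y) \<in> space (law n).
        s n powr (1 - \<nu>) \<le> cond_num (hessian_mat k \<psi> (lam n (m n)) n x (what n x y)) \<and>
        cond_num (hessian_mat k \<psi> (lam n (m n)) n x (what n x y))
          \<le> cond_num (gram_mat k n x) * (1 + t n / lam n (m n))}"
  \<comment> \<open>A convergent sequence is bounded; \<open>B\<close> serves as the additive
    constant in the comparison of rates.\<close>
  obtain B where B: "\<And>n. \<bar>lam n (m n)\<bar> \<le> B"
    using convergent_imp_Bseq[OF lam_lim] by (auto simp: Bseq_def)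
  \<comment> \<open>The Markov level is \<open>c = s n powr (\<nu> / 2)\<close>. Large
    \<open>n\<close> also ensures \<open>n \<ge> 1\<close> and \<open>s n > 0\<close>.\<close>
  have "\<forall>\<^sub>F n in sequentially. F n (t n) - F n (s n) - M / s n powr (\<nu> / 2) \<le> measure (law n) (?E n)"
    using mean_bound rate_eventually[OF s_lim nu eps_pos, of B] eventually_ge_at_top[of 1]
      eventually_compose_filterlim[OF eventually_gt_at_top[of 0] s_lim]
  proof eventually_elim
    case (elim n)
    have "s n powr (\<nu> / 2) + lam n (m n) \<le> \<epsilon> * s n powr \<nu>"
      using elim(2) B[of n] by linarith
    with elim show ?case
      unfolding F_def law_def
      by (intro cond_num_event_probability[OF P Q(1) rkhs k_meas eps_pos k_bounds
            gram_pd[unfolded law_def] psi_convex psi_diff lam_pos _ what_min[unfolded law_def]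
            what_meas[unfolded law_def]])
        (auto simp: law_def)
  qed
  moreover have "\<forall>\<^sub>F n in sequentially. measure (law n) (?E n) \<le> 1"
    unfolding law_def
    by (intro always_eventually allI prob_space.prob_le_1 prob_space_sample_law P Q)
  \<comment> \<open>The lower bound tends to 1, so the probability is squeezed against the trivial
    upper bound 1.\<close>
  moreover have "(\<lambda>n. F n (t n) - F n (s n) - M / s n powr (\<nu> / 2)) \<longlonglongrightarrow> 1 - 0 - 0"
    by (intro tendsto_diff F_t F_s rate_tendsto[OF s_lim nu])
  ultimately show "(\<lambda>n. measure (law n) (?E n)) \<longlonglongrightarrow> 1"
    using tendsto_sandwich[OF _ _ _ tendsto_const[of 1]] by simp
qed

end
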